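(* Let $a,b\geq 0$ be integers and let $\mathcal{T}$ be any flag triangulation of the boundary $\partial P_{K_{a+1,b+1}}$ into unimodular lattice simplices. Write its $h$-polynomial as $h(t)=\sum_{i\ge 0}\gamma_i t^i(1+t)^{a+b+1-2i}$. Then $\sum_i\gamma_i t^i$ is the $f$-polynomial of a flag balanced simplicial complex.
   Context: $P_G=\mathrm{conv}(e_v-e_w,\,e_w-e_v : vw\in E)\subset\mathbb{R}^V$ is the symmetric edge polytope of a finite simple graph $G=(V,E)$; $K_{a+1,b+1}$ is the complete bipartite graph with parts of sizes $a+1,b+1$; $P_{K_{a+1,b+1}}$ has dimension $a+b+1$, so its boundary is an $(a+b)$-dimensional sphere. A lattice simplex is unimodular if its vertices affinely generate the lattice $\mathbb{Z}^V\cap\operatorname{aff}(\text{simplex})$. A simplicial complex is flag if every minimal non-face has two elements; a $(d-1)$-dimensional complex is balanced if its vertices admit a coloring with $d$ colors such that the vertices of every face receive distinct colors. For a $(d-1)$-dimensional simplicial complex with $f_{i}$ faces of dimension $i$ ($f_{-1}=1$), the $f$-polynomial is $f(t)=\sum_{i=0}^{d} f_{i-1}t^{i}$ and the $h$-polynomial $h(t)=\sum_i h_it^i$ is defined by $f(t)=\sum_{i=0}^{d}h_it^i(1+t)^{d-i}$. *)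

theory Defs
  imports "HOL-Analysis.Analysis" "HOL-Computational_Algebra.Polynomial"
begin

section \<open>Symmetric edge polytopes\<close>

text \<open>A graph on the vertex set \<^term>\<open>UNIV :: 'v set\<close> is given by its set of edges, each edge
  being a two-element set of vertices.\<close>

definition complete_bipartite_edges :: "'v set \<Rightarrow> 'v set \<Rightarrow> 'v set set" where
  "complete_bipartite_edges A B = {{x, y} | x y. x \<in> A \<and> y \<in> B}"

text \<open>Since \<^term>\<open>{v, w} = {w, v}\<close>, both \<open>e\<^sub>v - e\<^sub>w\<close> and \<open>e\<^sub>w - e\<^sub>v\<close> occur for each edge.\<close>

definition symmetric_edge_polytope :: "'v::finite set set \<Rightarrow> (real ^ 'v) set" where
  "symmetric_edge_polytope E = convex hull {axis v 1 - axis w 1 | v w. {v, w} \<in> E}"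

section \<open>Unimodular triangulations\<close>

definition vertices_of :: "'a::euclidean_space set \<Rightarrow> 'a set" where
  "vertices_of S = {x. x extreme_point_of S}"

definition integer_lattice :: "(real ^ 'v::finite) set" where
  "integer_lattice = {x. \<forall>i. x $ i \<in> \<int>}"

definition integer_affine_span :: "'a::real_vector set \<Rightarrow> 'a set" where
  "integer_affine_span X =
     {(\<Sum>v\<in>X. of_int (c v) *\<^sub>R v) | c :: 'a \<Rightarrow> int. (\<Sum>v\<in>X. c v) = 1}"

definition unimodular_lattice_simplex :: "(real ^ 'v::finite) set \<Rightarrow> bool" where
  "unimodular_lattice_simplex S \<longleftrightarrow>
     (\<exists>n. n simplex S) \<and> vertices_of S \<subseteq> integer_lattice \<and>
     integer_affine_span (vertices_of S) = integer_lattice \<inter> affine hull S"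

text \<open>The library's \<^const>\<open>simplicial_complex\<close> is a finite geometric complex, closed under faces
  and hence containing the empty face. Polytopes need not be full-dimensional, so the boundary is
  the relative one.\<close>

definition boundary_triangulation :: "'a::euclidean_space set set \<Rightarrow> 'a set \<Rightarrow> bool" where
  "boundary_triangulation T P \<longleftrightarrow> simplicial_complex T \<and> \<Union>T = rel_frontier P"

definition vertex_scheme :: "'a::euclidean_space set set \<Rightarrow> 'a set set" where
  "vertex_scheme T = vertices_of ` T"

section \<open>Abstract simplicial complexes\<close>

text \<open>The vertex set of a complex \<^term>\<open>K\<close> is \<^term>\<open>\<Union>K\<close>. The empty set is always a face
  (\<open>f\<^bsub>-1\<^esub> = 1\<close>), so the smallest complex is \<^term>\<open>{{}}\<close>, of dimension \<open>-1\<close>.\<close>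

definition abstract_complex :: "'a set set \<Rightarrow> bool" where
  "abstract_complex K \<longleftrightarrow>
     finite K \<and> {} \<in> K \<and> (\<forall>F\<in>K. finite F \<and> (\<forall>G. G \<subseteq> F \<longrightarrow> G \<in> K))"

text \<open>One more than the dimension, i.e. the number \<open>d\<close> for a \<open>(d-1)\<close>-dimensional complex.\<close>

definition complex_rank :: "'a set set \<Rightarrow> nat" where
  "complex_rank K = Max (card ` K)"

definition minimal_nonface :: "'a set set \<Rightarrow> 'a set \<Rightarrow> bool" where
  "minimal_nonface K F \<longleftrightarrow> F \<subseteq> \<Union>K \<and> F \<notin> K \<and> (\<forall>G. G \<subset> F \<longrightarrow> G \<in> K)"

definition flag_complex :: "'a set set \<Rightarrow> bool" where
  "flag_complex K \<longleftrightarrow> (\<forall>F. minimal_nonface K F \<longrightarrow> card F = 2)"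

definition balanced_complex :: "'a set set \<Rightarrow> bool" where
  "balanced_complex K \<longleftrightarrow>
     (\<exists>c :: 'a \<Rightarrow> nat. c ` \<Union>K \<subseteq> {..<complex_rank K} \<and> (\<forall>F\<in>K. inj_on c F))"

section \<open>The polynomials f, h and gamma\<close>

definition f_polynomial :: "'a set set \<Rightarrow> int poly" where
  "f_polynomial K = (\<Sum>i\<le>complex_rank K. monom (int (card {F \<in> K. card F = i})) i)"

definition h_expansion :: "nat \<Rightarrow> int poly \<Rightarrow> int poly \<Rightarrow> bool" where
  "h_expansion d f h \<longleftrightarrow>
     degree h \<le> d \<and> f = (\<Sum>i\<le>d. monom (coeff h i) i * [:1, 1:] ^ (d - i))"

definition h_polynomial :: "'a set set \<Rightarrow> int poly" where
  "h_polynomial K = (THE h. h_expansion (complex_rank K) (f_polynomial K) h)"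

text \<open>The expansion \<open>h(t) = \<Sum>\<^sub>i \<gamma>\<^sub>i t\<^sup>i (1 + t)\<^bsup>n - 2i\<^esup>\<close>. The bound on the degree of \<open>\<gamma>\<close> keeps
  all exponents nonnegative, so that the subtraction on \<^typ>\<open>nat\<close> is exact.\<close>

definition gamma_expansion :: "nat \<Rightarrow> int poly \<Rightarrow> int poly \<Rightarrow> bool" where
  "gamma_expansion n h g \<longleftrightarrow>
     2 * degree g \<le> n \<and>
     h = (\<Sum>i\<le>n div 2. monom (coeff g i) i * [:1, 1:] ^ (n - 2 * i))"

subsection \<open>Existence and uniqueness of the expansions\<close>

lemma triangular_unique:
  fixes c :: "nat \<Rightarrow> int" and p :: "nat \<Rightarrow> int poly"
  assumes "(\<Sum>i\<le>m. monom (c i) i * p i) = 0" and "\<And>i. coeff (p i) 0 = 1" and "i \<le> m"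
  shows "c i = 0"
  using assms(3)
proof (induction i rule: less_induct)
  case (less j)
  have coeff_term: "coeff (monom (c i) i * p i) j = (if i = j then c j else 0)" if "i \<le> m" for i
    using less that assms(2) by (auto simp: coeff_monom_mult)
  have "0 = coeff (\<Sum>i\<le>m. monom (c i) i * p i) j"
    using assms(1) by simp
  also have "\<dots> = (\<Sum>i\<le>m. if i = j then c j else 0)"
    unfolding coeff_sum by (rule sum.cong) (use coeff_term in auto)
  also have "\<dots> = c j"
    using less.prems by simp
  finally show ?case by simp
qed

lemma triangular_poly_unique:
  fixes g g' :: "int poly" and p :: "nat \<Rightarrow> int poly"
  assumes "degree g \<le> m" "degree g' \<le> m" and "\<And>i. coeff (p i) 0 = 1"
    and "(\<Sum>i\<le>m. monom (coeff g i) i * p i) = (\<Sum>i\<le>m. monom (coeff g' i) i * p i)"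
  shows "g = g'"
proof (rule poly_eqI)
  fix i
  have "(\<Sum>i\<le>m. monom (coeff g i - coeff g' i) i * p i) = 0"
    using assms(4)
    by (simp only: diff_monom[symmetric] left_diff_distrib sum_subtractf right_minus_eq)
  from triangular_unique[OF this assms(3)] show "coeff g i = coeff g' i"
    using assms(1,2) by (cases "i \<le> m") (auto simp: coeff_eq_0)
qed

lemma gamma_expansion_unique:
  assumes "gamma_expansion n h g" "gamma_expansion n h g'"
  shows "g = g'"
proof (rule triangular_poly_unique)
  show "degree g \<le> n div 2" "degree g' \<le> n div 2"
    using assms unfolding gamma_expansion_def by linarith+
  show "coeff ([:1, 1:] ^ (n - 2 * i) :: int poly) 0 = 1" for i
    by (simp add: coeff_0_power)
  show "(\<Sum>i\<le>n div 2. monom (coeff g i) i * [:1, 1:] ^ (n - 2 * i)) =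
        (\<Sum>i\<le>n div 2. monom (coeff g' i) i * [:1, 1:] ^ (n - 2 * i))"
    using assms unfolding gamma_expansion_def by metis
qed

lemma h_expansion_unique:
  assumes "h_expansion d f h" "h_expansion d f h'"
  shows "h = h'"
proof (rule triangular_poly_unique)
  show "degree h \<le> d" "degree h' \<le> d"
    using assms unfolding h_expansion_def by linarith+
  show "coeff ([:1, 1:] ^ (d - i) :: int poly) 0 = 1" for i
    by (simp add: coeff_0_power)
  show "(\<Sum>i\<le>d. monom (coeff h i) i * [:1, 1:] ^ (d - i)) =
        (\<Sum>i\<le>d. monom (coeff h' i) i * [:1, 1:] ^ (d - i))"
    using assms unfolding h_expansion_def by metis
qed

lemma h_expansion_exists:
  assumes "degree f \<le> d"
  shows "\<exists>h. h_expansion d f h"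
  using assms
proof (induction d arbitrary: f)
  case 0
  then have "h_expansion 0 f f"
    by (auto simp: h_expansion_def elim: degree_eq_zeroE simp: monom_0)
  then show ?case ..
next
  case (Suc d)
  define q where "q = f - smult (coeff f 0) ([:1, 1:] ^ Suc d)"
  have "coeff q 0 = 0"
    by (simp add: q_def coeff_0_power del: power_Suc)
  then obtain r where r: "q = pCons 0 r"
    by (cases q) auto
  have "degree q \<le> Suc d"
    unfolding q_def using Suc.prems
    by (intro degree_diff_le) (auto intro!: order.trans[OF degree_smult_le] simp: degree_linear_power simp del: power_Suc)
  then have "degree r \<le> d"
    by (auto simp: r split: if_splits)
  then obtain h where h: "h_expansion d r h"
    using Suc.IH by blast
  have "f = smult (coeff f 0) ([:1, 1:] ^ Suc d) + pCons 0 r"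
    using r by (simp add: q_def algebra_simps)
  also have "pCons 0 r = (\<Sum>i\<le>d. monom (coeff h i) (Suc i) * [:1, 1:] ^ (d - i))"
  proof -
    have "pCons 0 r = [:0, 1:] * r" by simp
    also have "\<dots> = [:0, 1:] * (\<Sum>i\<le>d. monom (coeff h i) i * [:1, 1:] ^ (d - i))"
      using h unfolding h_expansion_def by metis
    also have "\<dots> = (\<Sum>i\<le>d. monom (coeff h i) (Suc i) * [:1, 1:] ^ (d - i))"
      unfolding sum_distrib_left by (rule sum.cong) (auto simp: monom_Suc)
    finally show ?thesis .
  qed
  also have "smult (coeff f 0) ([:1, 1:] ^ Suc d) + \<dots>
      = (\<Sum>i\<le>Suc d. monom (coeff (pCons (coeff f 0) h) i) i * [:1, 1:] ^ (Suc d - i))"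
    unfolding sum.atMost_Suc_shift by (simp add: monom_0 del: power_Suc)
  finally have "h_expansion (Suc d) f (pCons (coeff f 0) h)"
    using h by (auto simp: h_expansion_def)
  then show ?case ..
qed

lemma h_expansion_h_polynomial: "h_expansion (complex_rank K) (f_polynomial K) (h_polynomial K)"
proof -
  have "degree (f_polynomial K) \<le> complex_rank K"
    unfolding f_polynomial_def
    by (intro degree_sum_le) (auto intro: order.trans[OF degree_monom_le])
  then show ?thesis
    unfolding h_polynomial_def
    using h_expansion_exists h_expansion_unique by (metis theI)
qed

end

theory Submission
  imports Defs "HOL-Computational_Algebra.Polynomial_FPS"
begin

text \<open>Write \<open>w = z / (1 - z)\<close>. A unimodular simplex with \<open>i\<close> vertices has \<open>[z\<^sup>m] w\<^sup>i\<close> lattice points in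
  the relative interior of its \<open>m\<close>-th dilate, so counting the lattice points of the dilated boundary
  determines the \<open>f\<close>-polynomial of every unimodular triangulation: \<open>f(w)\<close> is the series of these
  counts. The polytope is cut out of the hyperplane of coordinate sum zero by
  \<open>\<parallel>x\<^sub>A\<parallel>\<^sub>1 \<le> 1\<close> and \<open>\<parallel>x\<^sub>B\<parallel>\<^sub>1 \<le> 1\<close>, where
  \<open>x\<^sub>A\<close> and \<open>x\<^sub>B\<close> are the restrictions of \<open>x\<close> to the two parts. Dropping one redundant coordinate
  from each part, the lattice points correspond to pairs of integer vectors in \<open>\<int>\<^sup>a\<close> and \<open>\<int>\<^sup>b\<close>
  whose positive parts have sum at most \<open>p\<close> and whose negative parts have sum at most \<open>q\<close>,
  with \<open>p + q\<close> fixed. Summation gives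
  \<open>f(t) = \<Sum>\<^sub>n \<gamma>\<^sub>n (t + t\<^sup>2)\<^sup>n (1 + 2t)\<^bsup>a+b+1-2n\<^esup>\<close>, where \<open>\<gamma>\<^sub>n\<close> counts the quadruples of subsets
  \<open>J, L\<close> of \<open>[a]\<close> and \<open>J', L'\<close> of \<open>[b]\<close> with \<open>J \<inter> L = J' \<inter> L' = {}\<close>, \<open>|J| = |J'|\<close>, \<open>|L| = |L'|\<close> and
  \<open>|J| + |L| = n\<close>. Matching \<open>J\<close> with \<open>J'\<close> and \<open>L\<close> with \<open>L'\<close> increasingly turns such quadruples into the
  cliques of a graph on the signed pairs \<open>[a] \<times> [b] \<times> {+, -}\<close>; for \<open>a \<le> b\<close> the first coordinate is
  a coloring that makes the clique complex balanced.\<close>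

section \<open>The generating function\<close>

text \<open>The sum of \<open>g i l\<close> over all sign vectors in \<open>{0, +, -}\<^sup>a\<close>, where \<open>i\<close> and \<open>l\<close> are the numbers of
  entries \<open>+\<close> and \<open>-\<close>.\<close>

primrec trinomial_sum :: "nat \<Rightarrow> (nat \<Rightarrow> nat \<Rightarrow> 'a::comm_semiring_1) \<Rightarrow> 'a" where
  "trinomial_sum 0 g = g 0 0"
| "trinomial_sum (Suc a) g =
     trinomial_sum a g + trinomial_sum a (\<lambda>i l. g (Suc i) l) + trinomial_sum a (\<lambda>i l. g i (Suc l))"

lemma trinomial_sum_add:
  "trinomial_sum a (\<lambda>i l. f i l + g i l) = trinomial_sum a f + trinomial_sum a g"
  by (induction a arbitrary: f g) (simp_all add: algebra_simps)

lemma trinomial_sum_0 [simp]: "trinomial_sum a (\<lambda>i l. 0) = 0"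
  by (induction a) simp_all

lemma trinomial_sum_mult_left: "trinomial_sum a (\<lambda>i l. c * g i l) = c * trinomial_sum a g"
  by (induction a arbitrary: g) (simp_all add: algebra_simps)

lemma trinomial_sum_mult_right: "trinomial_sum a (\<lambda>i l. g i l * c) = trinomial_sum a g * c"
  using trinomial_sum_mult_left[of a c g] by (simp add: mult.commute)

lemma trinomial_sum_sum:
  "trinomial_sum a (\<lambda>i l. \<Sum>k\<in>S. g k i l) = (\<Sum>k\<in>S. trinomial_sum a (g k))"
  by (induction a arbitrary: g) (simp_all add: sum.distrib)

lemma trinomial_sum_swap: "trinomial_sum a (\<lambda>i l. g l i) = trinomial_sum a g"
proof (induction a arbitrary: g)
  case (Suc a)
  show ?case
    unfolding trinomial_sum.simps Suc.IH[of g] Suc.IH[of "\<lambda>i l. g i (Suc l)"]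
      Suc.IH[of "\<lambda>i l. g (Suc i) l"]
    by (simp only: ac_simps)
qed simp

lemma trinomial_sum_product:
  "trinomial_sum a f * trinomial_sum b g =
    trinomial_sum a (\<lambda>i l. trinomial_sum b (\<lambda>i' l'. f i l * g i' l'))"
  by (simp only: trinomial_sum_mult_left trinomial_sum_mult_right)

lemma trinomial_sum_cong:
  "(\<And>i l. i \<le> a \<Longrightarrow> l \<le> a \<Longrightarrow> f i l = g i l) \<Longrightarrow> trinomial_sum a f = trinomial_sum a g"
proof (induction a arbitrary: f g)
  case (Suc a)
  have "trinomial_sum a f = trinomial_sum a g"
    "trinomial_sum a (\<lambda>i l. f (Suc i) l) = trinomial_sum a (\<lambda>i l. g (Suc i) l)"
    "trinomial_sum a (\<lambda>i l. f i (Suc l)) = trinomial_sum a (\<lambda>i l. g i (Suc l))"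
    by (rule Suc.IH; simp add: Suc.prems)+
  then show ?case by simp
qed simp

lemma of_nat_trinomial_sum:
  "of_nat (trinomial_sum a g) = trinomial_sum a (\<lambda>i l. of_nat (g i l))"
  by (induction a arbitrary: g) simp_all

lemma fps_nth_trinomial_sum:
  "fps_nth (trinomial_sum a g) n = trinomial_sum a (\<lambda>i l. fps_nth (g i l) n)"
  by (induction a arbitrary: g) simp_all

text \<open>The coefficient of x^k in (w + x)^j. The truncated exponent is harmless, because the
  binomial coefficient vanishes for \<open>j < k\<close>.\<close>

definition binomial_term :: "'a::comm_semiring_1 \<Rightarrow> nat \<Rightarrow> nat \<Rightarrow> 'a" where
  "binomial_term w k j = of_nat (j choose k) * w ^ (j - k)"

lemma binomial_term_0 [simp]: "binomial_term w 0 j = w ^ j"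
  "binomial_term w (Suc k) 0 = 0"
  by (simp_all add: binomial_term_def)

lemma binomial_term_eq_0: "j < k \<Longrightarrow> binomial_term w k j = 0"
  by (simp add: binomial_term_def binomial_eq_0)

lemma binomial_term_Suc_Suc:
  "binomial_term w (Suc k) (Suc j) = w * binomial_term w (Suc k) j + binomial_term w k j"
proof (cases "Suc k \<le> j")
  case True
  then have "w ^ (j - k) = w * w ^ (j - Suc k)"
    by (metis Suc_diff_Suc Suc_le_lessD power_Suc)
  then show ?thesis by (simp add: binomial_term_def algebra_simps)
next
  case False
  then show ?thesis by (cases "j = k") (simp_all add: binomial_term_def binomial_eq_0)
qed

text \<open>The multinomial coefficient a! / (k! l! (a - k - l)!), written as a product of binomials
  so that it is 0 for \<open>a < k + l\<close>.\<close>

definition trinomial :: "nat \<Rightarrow> nat \<Rightarrow> nat \<Rightarrow> nat" where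
  "trinomial a k l = (a choose (k + l)) * ((k + l) choose k)"

lemma trinomial_eq_0: "a < k + l \<Longrightarrow> trinomial a k l = 0"
  by (simp add: trinomial_def binomial_eq_0)

lemma trinomial_Suc:
  "trinomial (Suc a) k l = trinomial a k l + (if k = 0 then 0 else trinomial a (k - 1) l)
     + (if l = 0 then 0 else trinomial a k (l - 1))"
  by (cases k; cases l) (simp_all add: trinomial_def algebra_simps)

text \<open>Compare the coefficients of x^k y^l in (1 + (w + x) + (w + y))^a = ((1 + 2w) + x + y)^a.
  The induction on \<open>a\<close> multiplies by one more factor.\<close>

lemma trinomial_sum_binomial_term:
  fixes w :: "'a::comm_semiring_1"
  shows "trinomial_sum a (\<lambda>i j. binomial_term w k i * binomial_term w l j) =
    of_nat (trinomial a k l) * (1 + 2 * w) ^ (a - (k + l))"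
proof (induction a arbitrary: k l)
  case 0
  then show ?case by (cases k; cases l) (simp_all add: trinomial_def)
next
  case (Suc a)
  define R where "R k l = of_nat (trinomial a k l) * (1 + 2 * w) ^ (a - (k + l))" for k l
  define g where "g k l = (\<lambda>i j. binomial_term w k i * binomial_term w l j)" for k l
  \<comment> \<open>The shifted term of \<open>binomial_term_Suc_Suc\<close>, set to 0 for
    \<open>k = 0\<close> so that one recurrence covers all \<open>k\<close>.\<close>
  define s where "s k i = (if k = 0 then 0 else binomial_term w (k - 1) i)" for k i
  have IH: "trinomial_sum a (g k l) = R k l" for k l
    using Suc.IH by (simp add: g_def R_def)
  have s: "binomial_term w k (Suc i) = w * binomial_term w k i + s k i" for k i
    by (cases k) (simp_all add: s_def binomial_term_Suc_Suc)
  have s1: "trinomial_sum a (\<lambda>i j. s k i * binomial_term w l j) = (if k = 0 then 0 else R (k - 1) l)"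
    using IH[of "k - 1" l] by (simp add: s_def g_def)
  have s2: "trinomial_sum a (\<lambda>i j. binomial_term w k i * s l j) = (if l = 0 then 0 else R k (l - 1))"
    using IH[of k "l - 1"] by (simp add: s_def g_def)
  have "trinomial_sum (Suc a) (g k l) = R k l
      + trinomial_sum a (\<lambda>i j. w * g k l i j + s k i * binomial_term w l j)
      + trinomial_sum a (\<lambda>i j. w * g k l i j + binomial_term w k i * s l j)"
  proof -
    have "(\<lambda>i j. g k l (Suc i) j) = (\<lambda>i j. w * g k l i j + s k i * binomial_term w l j)"
      "(\<lambda>i j. g k l i (Suc j)) = (\<lambda>i j. w * g k l i j + binomial_term w k i * s l j)"
      by (simp_all add: g_def s algebra_simps)
    then show ?thesis by (simp only: trinomial_sum.simps IH)
  qed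
  also have "\<dots> = (1 + 2 * w) * R k l + (if k = 0 then 0 else R (k - 1) l)
      + (if l = 0 then 0 else R k (l - 1))"
  proof -
    have "(1 + 2 * w) * R k l = R k l + w * R k l + w * R k l"
      by (simp only: mult_2 distrib_right mult_1_left add.assoc)
    then show ?thesis
      unfolding trinomial_sum_add trinomial_sum_mult_left s1 s2 IH by (simp only: ac_simps)
  qed
  also have "\<dots> = of_nat (trinomial (Suc a) k l) * (1 + 2 * w) ^ (Suc a - (k + l))"
  proof -
    \<comment> \<open>For \<open>k + l > a\<close> both exponents are cut off at 0, but then
      \<open>trinomial a k l\<close> is 0.\<close>
    have e: "(1 + 2 * w) * R k l = of_nat (trinomial a k l) * (1 + 2 * w) ^ (Suc a - (k + l))"
    proof (cases "k + l \<le> a")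
      case True
      then have "Suc a - (k + l) = Suc (a - (k + l))" by simp
      then show ?thesis by (simp only: R_def power_Suc) (rule mult.left_commute)
    next
      case False
      then show ?thesis by (simp add: R_def trinomial_eq_0)
    qed
    show ?thesis
      unfolding e trinomial_Suc
      by (cases k; cases l) (simp_all add: R_def distrib_right)
  qed
  finally show ?case by (simp only: g_def)
qed

section \<open>Power series of products of two binomial coefficients\<close>

definition geo :: "int fps" where "geo = Abs_fps (\<lambda>n. 1)"
text \<open>This is w = z / (1 - z), and \<open>geo\<close> is 1 / (1 - z).\<close>

definition geo_tail :: "int fps" where "geo_tail = Abs_fps (\<lambda>n. if n = 0 then 0 else 1)"

lemma fps_nth_geo_tail [simp]: "fps_nth geo_tail n = (if n = 0 then 0 else 1)"
  by (simp add: geo_tail_def)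

lemma fps_X_mult_geo: "fps_X * geo = geo_tail"
  by (rule fps_ext) (auto simp: geo_def geo_tail_def)

lemma geo_eq: "geo = 1 + geo_tail"
  by (rule fps_ext) (auto simp: geo_def geo_tail_def)

lemma one_minus_fps_X_mult_geo: "(1 - fps_X) * geo = 1"
  using fps_X_mult_geo geo_eq by (simp add: algebra_simps)

lemma geo_cancel: "(1 - fps_X) * f = g \<Longrightarrow> f = geo * g"
  using one_minus_fps_X_mult_geo by (metis mult.assoc mult.commute mult.left_neutral)

definition binomial_products :: "nat \<Rightarrow> nat \<Rightarrow> int fps" where
  "binomial_products j k = Abs_fps (\<lambda>p. int ((p choose j) * (p choose k)))"

lemma binomial_products_0_0: "binomial_products 0 0 = geo"
  by (simp add: binomial_products_def geo_def)

lemma binomial_products_Suc_0: "binomial_products 0 (Suc k) = geo_tail * binomial_products 0 k"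
proof -
  have "(1 - fps_X) * binomial_products 0 (Suc k) = fps_X * binomial_products 0 k"
  proof (rule fps_ext)
    fix n show "fps_nth ((1 - fps_X) * binomial_products 0 (Suc k)) n = fps_nth (fps_X * binomial_products 0 k) n"
      by (cases n) (simp_all add: left_diff_distrib binomial_products_def)
  qed
  from geo_cancel[OF this] show ?thesis
    by (metis fps_X_mult_geo mult.assoc mult.commute)
qed

lemma binomial_products_0: "binomial_products 0 k = geo * geo_tail ^ k"
  by (induction k) (simp_all add: binomial_products_0_0 binomial_products_Suc_0)

lemma binomial_products_commute: "binomial_products j k = binomial_products k j"
  by (simp add: binomial_products_def mult.commute)

text \<open>Multiplying by 1 - z takes differences of consecutive coefficients, and Pascal's rule in
  both factors turns such a difference into the three products on the right.\<close>

lemma binomial_products_Suc_Suc: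
  "binomial_products (Suc j) (Suc k) = geo_tail * (binomial_products j k + binomial_products j (Suc k)
      + binomial_products (Suc j) k)"
proof -
  let ?R = "binomial_products j k + binomial_products j (Suc k) + binomial_products (Suc j) k"
  have "(1 - fps_X) * binomial_products (Suc j) (Suc k) = fps_X * ?R"
  proof (rule fps_ext)
    fix n show "fps_nth ((1 - fps_X) * binomial_products (Suc j) (Suc k)) n = fps_nth (fps_X * ?R) n"
      by (cases n) (simp_all add: left_diff_distrib binomial_products_def algebra_simps)
  qed
  from geo_cancel[OF this] show ?thesis
    by (metis fps_X_mult_geo mult.assoc mult.commute)
qed

text \<open>For \<open>N\<close> at least the minimum of \<open>j\<close> and \<open>k\<close>, a
  Delannoy number in which every lattice step has weight \<open>w\<close>: the coefficient of x^j
  y^k in 1 / (1 - w (x + y + xy)). Terms beyond that minimum vanish, so one cutoff \<open>N\<close>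
  can serve many \<open>j\<close> and \<open>k\<close>, and sums can be interchanged.\<close>

definition delannoy_sum :: "'a::comm_ring_1 \<Rightarrow> nat \<Rightarrow> nat \<Rightarrow> nat \<Rightarrow> 'a" where
  "delannoy_sum w N j k = (\<Sum>i\<le>N. binomial_term w i j * binomial_term w i k * (w + w\<^sup>2) ^ i)"

lemma delannoy_sum_Suc:
  assumes "j \<le> N \<or> k \<le> N"
  shows "delannoy_sum w (Suc N) j k = delannoy_sum w N j k"
  using assms by (auto simp: delannoy_sum_def binomial_term_eq_0)

text \<open>By \<open>binomial_term_Suc_Suc\<close>, each factor of \<open>?D i\<close> drops to
  index \<open>i - 1\<close>, and is 0 for \<open>i = 0\<close>. Hence the sum of the
  \<open>?D i\<close> is v times a Delannoy sum, while expanding the product gives four Delannoy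
  sums. Since v - w^2 = w, the recurrence follows.\<close>

lemma delannoy_sum_Suc_Suc:
  assumes "Suc j \<le> N"
  shows "delannoy_sum w N (Suc j) (Suc k) =
    w * (delannoy_sum w N j k + delannoy_sum w N j (Suc k) + delannoy_sum w N (Suc j) k)"
proof -
  let ?B = "binomial_term w" and ?v = "w + w\<^sup>2"
  let ?D = "\<lambda>i. (?B i (Suc j) - w * ?B i j) * (?B i (Suc k) - w * ?B i k) * ?v ^ i"
  have "(\<Sum>i\<le>Suc N. ?D i) = ?D 0 + (\<Sum>i\<le>N. ?D (Suc i))"
    by (rule sum.atMost_Suc_shift)
  also have "\<dots> = ?v * delannoy_sum w N j k"
    by (simp add: binomial_term_Suc_Suc delannoy_sum_def sum_distrib_left algebra_simps)
  finally have 1: "(\<Sum>i\<le>Suc N. ?D i) = ?v * delannoy_sum w N j k" .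
  have "(\<Sum>i\<le>Suc N. ?D i) = delannoy_sum w (Suc N) (Suc j) (Suc k) - w * delannoy_sum w (Suc N) j (Suc k)
     - w * delannoy_sum w (Suc N) (Suc j) k + w\<^sup>2 * delannoy_sum w (Suc N) j k"
    unfolding delannoy_sum_def sum_distrib_left sum_subtractf[symmetric] sum.distrib[symmetric]
    by (rule sum.cong) (simp_all add: algebra_simps power2_eq_square)
  with 1 assms show ?thesis
    by (simp add: delannoy_sum_Suc algebra_simps)
qed

text \<open>Both sides satisfy the same recurrence and agree on the borders \<open>j = 0\<close> and
  \<open>k = 0\<close>, where only the summand \<open>i = 0\<close> of the Delannoy sum
  survives.\<close>

lemma binomial_products_eq:
  assumes "j \<le> N"
  shows "binomial_products j k = geo * delannoy_sum geo_tail N j k"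
  using assms
proof (induction j arbitrary: k)
  case 0
  have "delannoy_sum geo_tail N 0 k = (\<Sum>i\<in>{0}. binomial_term geo_tail i 0 * binomial_term geo_tail i k * (geo_tail + geo_tail\<^sup>2) ^ i)"
    unfolding delannoy_sum_def
    by (rule sum.mono_neutral_right) (auto simp: binomial_term_eq_0)
  then show ?case by (simp add: binomial_products_0)
next
  case (Suc j)
  note IHj = this
  show ?case
  proof (induction k)
    case 0
    have "delannoy_sum geo_tail N (Suc j) 0 = (\<Sum>i\<in>{0}. binomial_term geo_tail i (Suc j) * binomial_term geo_tail i 0 * (geo_tail + geo_tail\<^sup>2) ^ i)"
      unfolding delannoy_sum_def
      by (rule sum.mono_neutral_right) (auto simp: binomial_term_eq_0)
    then show ?case using binomial_products_0[of "Suc j"] by (simp add: binomial_products_commute)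
  next
    case (Suc k)
    then show ?case
      unfolding binomial_products_Suc_Suc delannoy_sum_Suc_Suc[OF IHj(2)]
      using IHj by (simp add: algebra_simps)
  qed
qed

text \<open>The number of vectors in \<open>\<int>\<^sup>a\<close> with positive part of sum at most \<open>p\<close> and negative part of sum at
  most \<open>q\<close>, classified by their sign vectors.\<close>

definition quadrant_count :: "nat \<Rightarrow> nat \<Rightarrow> nat \<Rightarrow> nat" where
  "quadrant_count a p q = trinomial_sum a (\<lambda>i l. (p choose i) * (q choose l))"

definition quadrant_series :: "nat \<Rightarrow> nat \<Rightarrow> int fps" where
  "quadrant_series a b =
     Abs_fps (\<lambda>m. int (\<Sum>p\<le>m. quadrant_count a p (m - p) * quadrant_count b p (m - p)))"

definition gamma_coeff :: "nat \<Rightarrow> nat \<Rightarrow> nat \<Rightarrow> nat" where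
  "gamma_coeff a b n = (\<Sum>k\<le>n. trinomial a k (n - k) * trinomial b k (n - k))"

lemma gamma_coeff_eq_0: "a < n \<or> b < n \<Longrightarrow> gamma_coeff a b n = 0"
  by (auto simp: gamma_coeff_def trinomial_eq_0)

text \<open>For fixed sign vectors on both parts, the sum over \<open>p\<close> is the Cauchy
  product of a series in \<open>p\<close> and a series in \<open>m - p\<close>.\<close>

lemma quadrant_series_eq_trinomial_sum:
  "quadrant_series a b =
    trinomial_sum a (\<lambda>i l. trinomial_sum b (\<lambda>i' l'. binomial_products i i' * binomial_products l l'))"
proof (rule fps_ext)
  fix m
  have "int (quadrant_count a p q * quadrant_count b p q) =
     trinomial_sum a (\<lambda>i l. trinomial_sum b (\<lambda>i' l'.
        int ((p choose i) * (p choose i')) * int ((q choose l) * (q choose l'))))" for p q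
    unfolding quadrant_count_def of_nat_mult of_nat_trinomial_sum trinomial_sum_product
    by (intro trinomial_sum_cong) simp
  then have "fps_nth (quadrant_series a b) m = (\<Sum>p\<le>m.
     trinomial_sum a (\<lambda>i l. trinomial_sum b (\<lambda>i' l'.
        int ((p choose i) * (p choose i')) * int (((m - p) choose l) * ((m - p) choose l')))))"
    by (simp add: quadrant_series_def)
  then show "fps_nth (quadrant_series a b) m = fps_nth (trinomial_sum a (\<lambda>i l. trinomial_sum b
      (\<lambda>i' l'. binomial_products i i' * binomial_products l l'))) m"
    by (simp add: fps_nth_trinomial_sum fps_mult_nth trinomial_sum_sum binomial_products_def atLeast0AtMost)
qed

text \<open>After the Delannoy expansion the summand is a product of a term for each part, so the
  two sums over sign vectors separate and \<open>trinomial_sum_binomial_term\<close> evaluates each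
  of them.\<close>

lemma quadrant_series_eq:
  "(1 - fps_X\<^sup>2) * quadrant_series a b =
    (\<Sum>n\<le>(a + b + 1) div 2. of_nat (gamma_coeff a b n) * (geo_tail + geo_tail\<^sup>2) ^ n *
        (1 + 2 * geo_tail) ^ (a + b + 1 - 2 * n))"
proof -
  define B where "B = binomial_term geo_tail"
  define v where "v = geo_tail + geo_tail\<^sup>2"
  define u where "u = 1 + 2 * geo_tail"
  define t where "t c k l = of_nat (trinomial c k l) * u ^ (c - (k + l))" for c k l
  have t: "trinomial_sum c (\<lambda>i j. B k i * B l j) = t c k l" for c k l
    by (simp add: B_def t_def u_def trinomial_sum_binomial_term)
  \<comment> \<open>In the sum over the first part \<open>i\<close> and \<open>l\<close> are at most
    \<open>a\<close>, so the cutoff \<open>a\<close> is large enough for both Delannoy sums.\<close>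
  have "quadrant_series a b = trinomial_sum a (\<lambda>i l. trinomial_sum b (\<lambda>i' l'.
      (geo * (\<Sum>k\<le>a. B k i * B k i' * v ^ k)) * (geo * (\<Sum>k\<le>a. B k l * B k l' * v ^ k))))"
    unfolding quadrant_series_eq_trinomial_sum
    by (intro trinomial_sum_cong)
      (simp add: binomial_products_eq[of _ a] delannoy_sum_def B_def v_def)
  also have "\<dots> = trinomial_sum a (\<lambda>i l. trinomial_sum b (\<lambda>i' l'.
      \<Sum>k\<le>a. \<Sum>k'\<le>a. geo\<^sup>2 * v ^ (k + k') * ((B k i * B k' l) * (B k i' * B k' l'))))"
  proof (intro trinomial_sum_cong)
    fix i l i' l'
    have "(geo * (\<Sum>k\<le>a. B k i * B k i' * v ^ k)) * (geo * (\<Sum>k\<le>a. B k l * B k l' * v ^ k)) =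
        geo\<^sup>2 * ((\<Sum>k\<le>a. B k i * B k i' * v ^ k) * (\<Sum>k\<le>a. B k l * B k l' * v ^ k))"
      by (simp only: power2_eq_square ac_simps)
    also have "\<dots> = (\<Sum>k\<le>a. \<Sum>k'\<le>a. geo\<^sup>2 * v ^ (k + k') * ((B k i * B k' l) * (B k i' * B k' l')))"
      unfolding sum_product
      apply (subst sum_distrib_left)
      apply (subst sum_distrib_left)
      apply (rule sum.cong[OF refl])+
      apply (simp only: power_add mult_ac)
      done
    finally show "(geo * (\<Sum>k\<le>a. B k i * B k i' * v ^ k)) * (geo * (\<Sum>k\<le>a. B k l * B k l' * v ^ k)) =
      (\<Sum>k\<le>a. \<Sum>k'\<le>a. geo\<^sup>2 * v ^ (k + k') * ((B k i * B k' l) * (B k i' * B k' l')))" .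
  qed
  also have "\<dots> = (\<Sum>k\<le>a. \<Sum>k'\<le>a. geo\<^sup>2 * v ^ (k + k') * (t a k k' * t b k k'))"
    by (simp only: trinomial_sum_sum trinomial_sum_mult_left trinomial_sum_mult_right t)
  \<comment> \<open>Outside the triangle \<open>k + k' <= a\<close> the trinomial coefficient
    vanishes; the remaining terms are then collected by n = k + k'.\<close>
  also have "\<dots> = (\<Sum>k\<le>a. \<Sum>k'\<le>a - k. geo\<^sup>2 * v ^ (k + k') * (t a k k' * t b k k'))"
    by (rule sum.cong[OF refl], rule sum.mono_neutral_right) (auto simp: t_def trinomial_eq_0)
  also have "\<dots> = (\<Sum>n\<le>a. \<Sum>k\<le>n. geo\<^sup>2 * v ^ n * (t a k (n - k) * t b k (n - k)))"
  proof -
    have "{(i, j). i + j \<le> a} = (SIGMA k:{..a}. {..a - k})" by auto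
    then show ?thesis
      using sum.triangle_reindex_eq[of "\<lambda>k k'. geo\<^sup>2 * v ^ (k + k') * (t a k k' * t b k k')" a]
      by (simp add: sum.Sigma)
  qed
  also have "\<dots> = geo\<^sup>2 * (\<Sum>n\<le>a. of_nat (gamma_coeff a b n) * v ^ n * (u ^ (a - n) * u ^ (b - n)))"
    unfolding sum_distrib_left
  proof (rule sum.cong[OF refl])
    fix n
    have "geo\<^sup>2 * v ^ n * (t a k (n - k) * t b k (n - k)) = (geo\<^sup>2 * v ^ n * (u ^ (a - n) * u ^ (b - n))) *
        of_nat (trinomial a k (n - k) * trinomial b k (n - k))" if "k \<le> n" for k
      using that by (simp add: t_def mult_ac)
    then have "(\<Sum>k\<le>n. geo\<^sup>2 * v ^ n * (t a k (n - k) * t b k (n - k))) =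
        (geo\<^sup>2 * v ^ n * (u ^ (a - n) * u ^ (b - n))) * of_nat (gamma_coeff a b n)"
      unfolding gamma_coeff_def of_nat_sum sum_distrib_left by (intro sum.cong) auto
    then show "(\<Sum>k\<le>n. geo\<^sup>2 * v ^ n * (t a k (n - k) * t b k (n - k))) =
        geo\<^sup>2 * (of_nat (gamma_coeff a b n) * v ^ n * (u ^ (a - n) * u ^ (b - n)))"
      by (simp only: mult_ac)
  qed
  finally have 1: "quadrant_series a b = geo\<^sup>2 *
    (\<Sum>n\<le>a. of_nat (gamma_coeff a b n) * v ^ n * (u ^ (a - n) * u ^ (b - n)))" .
  \<comment> \<open>In closed form: (1 - z^2) / (1 - z)^2 = (1 + z) / (1 - z) = 1 + 2w.\<close>
  have 2: "(1 - fps_X\<^sup>2) * (geo\<^sup>2 * f) = u * f" for f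
  proof -
    have "geo + fps_X * geo = u"
      unfolding fps_X_mult_geo by (simp add: geo_eq u_def)
    moreover have "(1 - fps_X\<^sup>2) * (geo\<^sup>2 * f) = ((1 - fps_X) * geo) * ((geo + fps_X * geo) * f)"
      by (simp add: algebra_simps power2_eq_square)
    ultimately show ?thesis
      by (simp only: one_minus_fps_X_mult_geo mult_1_left)
  qed
  have "(1 - fps_X\<^sup>2) * quadrant_series a b =
     u * (\<Sum>n\<le>a. of_nat (gamma_coeff a b n) * v ^ n * (u ^ (a - n) * u ^ (b - n)))"
    unfolding 1 by (rule 2)
  also have "\<dots> = (\<Sum>n\<le>a. of_nat (gamma_coeff a b n) * v ^ n * u ^ (a + b + 1 - 2 * n))"
    unfolding sum_distrib_left
  proof (rule sum.cong)
    fix n assume "n \<in> {..a}"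
    show "u * (of_nat (gamma_coeff a b n) * v ^ n * (u ^ (a - n) * u ^ (b - n))) =
      of_nat (gamma_coeff a b n) * v ^ n * u ^ (a + b + 1 - 2 * n)"
    proof (cases "n \<le> b")
      case True
      with \<open>n \<in> {..a}\<close> have "a + b + 1 - 2 * n = Suc ((a - n) + (b - n))" by auto
      then show ?thesis by (simp only: power_Suc power_add mult_ac)
    qed (simp add: gamma_coeff_eq_0)
  qed simp
  \<comment> \<open>The range of \<open>n\<close> is changed twice, ending with the one in
    \<open>gamma_expansion\<close>; terms with \<open>n > a\<close> or \<open>n > b\<close> are
    0.\<close>
  also have "\<dots> = (\<Sum>n\<le>min a b. of_nat (gamma_coeff a b n) * v ^ n * u ^ (a + b + 1 - 2 * n))"
    by (rule sum.mono_neutral_right) (auto simp: gamma_coeff_eq_0)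
  also have "\<dots> = (\<Sum>n\<le>(a + b + 1) div 2. of_nat (gamma_coeff a b n) * v ^ n * u ^ (a + b + 1 - 2 * n))"
  proof (rule sum.mono_neutral_left)
    show "{..min a b} \<subseteq> {..(a + b + 1) div 2}" by (rule atMost_subset_iff[THEN iffD2]) arith
    show "\<forall>n\<in>{..(a + b + 1) div 2} - {..min a b}.
        of_nat (gamma_coeff a b n) * v ^ n * u ^ (a + b + 1 - 2 * n) = 0"
    proof
      fix n assume "n \<in> {..(a + b + 1) div 2} - {..min a b}"
      then have "gamma_coeff a b n = 0" by (intro gamma_coeff_eq_0) auto
      then show "of_nat (gamma_coeff a b n) * v ^ n * u ^ (a + b + 1 - 2 * n) = 0" by simp
    qed
  qed simp
  finally show ?thesis unfolding u_def v_def .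
qed

section \<open>From the f-polynomial to the gamma-polynomial\<close>

lemma f_polynomial_eq_sum_monom:
  assumes "finite K"
  shows "f_polynomial K = (\<Sum>F\<in>K. monom 1 (card F))"
proof -
  have "(\<Sum>F\<in>K. monom (1::int) (card F)) = (\<Sum>i\<le>complex_rank K. \<Sum>F\<in>{F\<in>K. card F = i}. monom 1 (card F))"
    using assms by (intro sum.group[symmetric]) (auto simp: complex_rank_def)
  also have "\<dots> = f_polynomial K"
    unfolding f_polynomial_def by (intro sum.cong refl) (simp add: of_nat_poly smult_monom)
  finally show ?thesis ..
qed

lemma degree_f_polynomial:
  assumes "finite K" "K \<noteq> {}"
  shows "degree (f_polynomial K) = complex_rank K"
proof (rule antisym)
  show "degree (f_polynomial K) \<le> complex_rank K"
    unfolding f_polynomial_def by (intro degree_sum_le) (auto intro: order.trans[OF degree_monom_le])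
  have "complex_rank K \<in> card ` K"
    unfolding complex_rank_def using assms by (intro Max_in) auto
  then have "{F \<in> K. card F = complex_rank K} \<noteq> {}" by auto
  then have "coeff (f_polynomial K) (complex_rank K) \<noteq> 0"
    using assms by (simp add: f_polynomial_def coeff_sum)
  then show "complex_rank K \<le> degree (f_polynomial K)" by (rule le_degree)
qed

section \<open>Substituting w into a power series\<close>

lemma fps_nth_geo_tail_0: "fps_nth geo_tail 0 = 0" by simp

text \<open>Since w has subdegree 1, substituting it preserves subdegrees. The zero series has
  subdegree 0 by convention, so \<open>f - g\<close> has subdegree 0; its constant term vanishes
  too, which leaves only the zero series.\<close>

lemma fps_compose_geo_tail_inject:
  assumes "f oo geo_tail = g oo geo_tail"
  shows "f = g"
proof -
  have "subdegree geo_tail = 1" by (rule subdegreeI) auto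
  then have "subdegree (f - g) = 0"
    using subdegree_fps_compose[OF fps_nth_geo_tail_0, of "f - g"] assms by (simp add: fps_compose_sub_distrib)
  moreover have "fps_nth (f - g) 0 = 0"
    using assms by (metis fps_compose_nth_0 fps_sub_nth right_minus_eq)
  ultimately show ?thesis
    by (metis nth_subdegree_nonzero right_minus_eq)
qed

lemma fps_of_monom_compose_geo_tail: "fps_of_poly (monom 1 n) oo geo_tail = geo_tail ^ n"
proof -
  have "geo_tail ^ n = (fps_X oo geo_tail) ^ n"
    by (simp add: fps_X_fps_compose_startby0)
  also have "\<dots> = fps_X ^ n oo geo_tail" by (rule fps_compose_power) simp
  finally show ?thesis by (simp add: fps_of_poly_monom)
qed

text \<open>For \<open>degree h <= d\<close> this is (1 + t)^d h(t / (1 + t)), the right-hand side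
  of \<open>h_expansion\<close>. Being additive in \<open>h\<close>, it can be computed
  termwise.\<close>

definition homogenization :: "nat \<Rightarrow> int poly \<Rightarrow> int poly" where
  "homogenization d h = (\<Sum>i\<le>d. monom (coeff h i) i * [:1, 1:] ^ (d - i))"

lemma homogenization_sum: "homogenization d (\<Sum>x\<in>S. h x) = (\<Sum>x\<in>S. homogenization d (h x))"
  unfolding homogenization_def coeff_sum monom_sum sum_distrib_right by (rule sum.swap)

lemma homogenization_monom: 
  assumes "j \<le> d"
  shows "homogenization d (monom c j) = monom c j * [:1, 1:] ^ (d - j)"
proof -
  have "homogenization d (monom c j) = (\<Sum>i\<in>{j}. monom (coeff (monom c j) i) i * [:1, 1:] ^ (d - i))"
    unfolding homogenization_def using assms by (intro sum.mono_neutral_right) auto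
  then show ?thesis by simp
qed

text \<open>Under t -> t / (1 + t) the factor 1 + t becomes (1 + 2t) / (1 + t); multiplying by (1 +
  t)^(2i + k) clears all denominators.\<close>

lemma homogenization_palindrome:
  "homogenization (2 * i + k) (monom c i * [:1, 1:] ^ k) = smult c ([:0, 1:] ^ i * [:1, 1:] ^ i * [:1, 2:] ^ k)"
proof -
  let ?X = "[:0, 1:] :: int poly" and ?Y = "[:1, 1:] :: int poly"
  \<comment> \<open>The binomial theorem is used for \<open>?X + 1\<close> before the homogenization
    and, read backwards, for \<open>?X + ?Y\<close> after it.\<close>
  have Y: "?Y = ?X + 1" and Z: "[:1, 2:] = ?X + ?Y" by (simp_all add: one_pCons)
  have M: "monom (c * of_nat m) e = smult c (of_nat m * ?X ^ e)" for m e
    by (simp add: monom_altdef of_nat_poly)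
  have "monom c i * ?Y ^ k = (\<Sum>l\<le>k. monom (c * of_nat (k choose l)) (i + l))"
    unfolding Y binomial_ring sum_distrib_left
    by (intro sum.cong refl) (simp add: monom_altdef of_nat_poly power_add mult.commute[of c])
  then have "homogenization (2 * i + k) (monom c i * ?Y ^ k) =
      (\<Sum>l\<le>k. monom (c * of_nat (k choose l)) (i + l) * ?Y ^ (2 * i + k - (i + l)))"
    by (simp only: homogenization_sum) (rule sum.cong[OF refl], rule homogenization_monom, simp)
  also have "\<dots> = (\<Sum>l\<le>k. smult c (?X ^ i * ?Y ^ i * (of_nat (k choose l) * ?X ^ l * ?Y ^ (k - l))))"
  proof (rule sum.cong[OF refl])
    fix l assume "l \<in> {..k}"
    then have e: "2 * i + k - (i + l) = i + (k - l)" by auto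
    show "monom (c * of_nat (k choose l)) (i + l) * ?Y ^ (2 * i + k - (i + l)) =
        smult c (?X ^ i * ?Y ^ i * (of_nat (k choose l) * ?X ^ l * ?Y ^ (k - l)))"
      unfolding M e power_add mult_smult_left by (simp only: mult_ac)
  qed
  also have "\<dots> = smult c (?X ^ i * ?Y ^ i * [:1, 2:] ^ k)"
    unfolding Z binomial_ring sum_distrib_left by (simp add: poly_eq_iff coeff_sum sum_distrib_left)
  finally show ?thesis .
qed

definition gamma_f_poly :: "nat \<Rightarrow> nat \<Rightarrow> int poly" where
  "gamma_f_poly a b = (\<Sum>n\<le>(a + b + 1) div 2.
     smult (int (gamma_coeff a b n)) ([:0, 1:] ^ n * [:1, 1:] ^ n * [:1, 2:] ^ (a + b + 1 - 2 * n)))"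

lemma gamma_f_poly_compose_geo_tail:
  "fps_of_poly (gamma_f_poly a b) oo geo_tail = (1 - fps_X\<^sup>2) * quadrant_series a b"
proof -
  have "fps_of_poly [:c, d:] oo geo_tail = fps_const c + fps_const d * geo_tail" for c d :: int
    by (simp add: fps_of_poly_pCons fps_X_fps_compose_startby0 fps_compose_add_distrib
        fps_compose_mult_distrib mult.commute)
  then have X: "fps_of_poly [:0, 1:] oo geo_tail = geo_tail" and Y: "fps_of_poly [:1, 1:] oo geo_tail = 1 + geo_tail"
    and Z: "fps_of_poly [:1, 2:] oo geo_tail = 1 + 2 * geo_tail"
    by (simp_all add: numeral_fps_const)
  have "fps_of_poly (smult (int (gamma_coeff a b n))
        ([:0, 1:] ^ n * [:1, 1:] ^ n * [:1, 2:] ^ (a + b + 1 - 2 * n))) oo geo_tail =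
      of_nat (gamma_coeff a b n) * (geo_tail + geo_tail\<^sup>2) ^ n * (1 + 2 * geo_tail) ^ (a + b + 1 - 2 * n)" for n
  proof -
    have "geo_tail ^ n * (1 + geo_tail) ^ n = (geo_tail + geo_tail\<^sup>2) ^ n"
      by (simp only: power_mult_distrib[symmetric] distrib_left mult_1_right power2_eq_square)
    then show ?thesis
      unfolding fps_of_poly_smult fps_of_poly_mult fps_of_poly_power
        fps_compose_mult_distrib[OF fps_nth_geo_tail_0] fps_compose_power[OF fps_nth_geo_tail_0, symmetric] X Y Z
      by (simp add: mult.assoc flip: fps_of_nat)
  qed
  then show ?thesis
    unfolding quadrant_series_eq gamma_f_poly_def fps_of_poly_sum fps_compose_sum_distrib by simp
qed

text \<open>All polynomials in the sum have the same degree and positive leading coefficients, their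
  multipliers are nonnegative, and the one for \<open>n = 0\<close> is 1, so nothing cancels. This
  yields the dimension of the triangulation from the count alone.\<close>

lemma degree_gamma_f_poly: "degree (gamma_f_poly a b) = a + b + 1"
proof (rule antisym)
  let ?t = "\<lambda>n. [:0, 1:] ^ n * [:1, 1:] ^ n * [:1, 2 :: int:] ^ (a + b + 1 - 2 * n)"
  have deg: "degree (?t n) = a + b + 1" if "n \<le> (a + b + 1) div 2" for n
    using that by (simp add: degree_mult_eq degree_linear_power degree_power_eq)
  have lead: "coeff (?t n) (a + b + 1) = 2 ^ (a + b + 1 - 2 * n)" if "n \<le> (a + b + 1) div 2" for n
  proof -
    have "lead_coeff (?t n) = 2 ^ (a + b + 1 - 2 * n)"
      by (simp add: lead_coeff_mult lead_coeff_power)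
    then show ?thesis by (simp only: deg[OF that])
  qed
  show "degree (gamma_f_poly a b) \<le> a + b + 1"
    unfolding gamma_f_poly_def
    by (intro degree_sum_le) (auto intro!: order.trans[OF degree_smult_le] simp del: mult_pCons_left simp: deg[simplified])
  have "coeff (gamma_f_poly a b) (a + b + 1) =
      (\<Sum>n\<le>(a + b + 1) div 2. int (gamma_coeff a b n) * 2 ^ (a + b + 1 - 2 * n))"
    unfolding gamma_f_poly_def coeff_sum coeff_smult by (intro sum.cong refl) (simp only: lead atMost_iff)
  also have "\<dots> \<noteq> 0"
  proof -
    have "0 < int (gamma_coeff a b 0) * 2 ^ (a + b + 1 - 2 * 0)"
      by (simp add: gamma_coeff_def trinomial_def)
    then have "0 < (\<Sum>n\<le>(a + b + 1) div 2. int (gamma_coeff a b n) * 2 ^ (a + b + 1 - 2 * n))"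
      by (intro sum_pos2[of _ 0]) auto
    then show ?thesis by simp
  qed
  finally show "a + b + 1 \<le> degree (gamma_f_poly a b)" by (rule le_degree)
qed

text \<open>Injectivity of the substitution of w identifies the f-polynomial, and its degree is the
  rank. The polynomial \<open>h\<close> built from \<open>g\<close> has the right homogenization, so
  uniqueness of the h-expansion makes it the h-polynomial.\<close>

lemma gamma_expansion_h_polynomial:
  assumes "finite K" "K \<noteq> {}"
    and series: "(\<Sum>F\<in>K. geo_tail ^ card F) = (1 - fps_X\<^sup>2) * quadrant_series a b"
    and g: "2 * degree g \<le> a + b + 1" "\<And>n. coeff g n = int (gamma_coeff a b n)"
  shows "gamma_expansion (a + b + 1) (h_polynomial K) g"
proof -
  define N where "N = a + b + 1"
  define h where "h = (\<Sum>i\<le>N div 2. monom (coeff g i) i * [:1, 1:] ^ (N - 2 * i))"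
  have "fps_of_poly (f_polynomial K) oo geo_tail = fps_of_poly (gamma_f_poly a b) oo geo_tail"
    unfolding gamma_f_poly_compose_geo_tail series[symmetric] f_polynomial_eq_sum_monom[OF assms(1)]
      fps_of_poly_sum fps_compose_sum_distrib fps_of_monom_compose_geo_tail ..
  then have f: "f_polynomial K = gamma_f_poly a b"
    by (metis fps_compose_geo_tail_inject fps_of_poly_eq_iff)
  then have rank: "complex_rank K = N"
    using degree_f_polynomial[OF assms(1,2)] by (simp add: degree_gamma_f_poly N_def)
  have "degree h \<le> N"
    unfolding h_def
  proof (intro degree_sum_le)
    fix i assume "i \<in> {..N div 2}"
    then have "2 * i \<le> N" by simp
    have "degree (monom (coeff g i) i * [:1, 1:] ^ (N - 2 * i)) \<le> i + (N - 2 * i)"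
      by (intro order.trans[OF degree_mult_le] add_mono degree_monom_le) (simp add: degree_linear_power)
    also have "\<dots> \<le> N" using \<open>2 * i \<le> N\<close> by simp
    finally show "degree (monom (coeff g i) i * [:1, 1:] ^ (N - 2 * i)) \<le> N" .
  qed simp
  moreover have "homogenization N h = (\<Sum>i\<le>N div 2. homogenization (2 * i + (N - 2 * i)) (monom (coeff g i) i * [:1, 1:] ^ (N - 2 * i)))"
    unfolding h_def homogenization_sum by (intro sum.cong refl) simp
  then have "homogenization N h = gamma_f_poly a b"
    unfolding homogenization_palindrome gamma_f_poly_def g(2) N_def .
  ultimately have "h_expansion N (f_polynomial K) h"
    by (simp add: h_expansion_def f homogenization_def)
  then have "h_polynomial K = h"
    using h_expansion_h_polynomial[of K] h_expansion_unique unfolding rank by blast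
  then show ?thesis using g(1) by (simp add: gamma_expansion_def h_def N_def)
qed

section \<open>Complexes of signed matchings\<close>

definition clique_complex :: "'a set \<Rightarrow> ('a \<Rightarrow> 'a \<Rightarrow> bool) \<Rightarrow> 'a set set" where
  "clique_complex V R = {F. F \<subseteq> V \<and> pairwise R F}"

lemma abstract_complex_clique_complex: "finite V \<Longrightarrow> abstract_complex (clique_complex V R)"
  unfolding abstract_complex_def clique_complex_def
  by (auto intro: finite_subset pairwise_mono)

text \<open>A non-face contains an unrelated pair, which is a non-face itself and by minimality is
  everything.\<close>

lemma flag_complex_clique_complex: "flag_complex (clique_complex V R)"
  unfolding flag_complex_def
proof (intro allI impI)
  fix F assume F: "minimal_nonface (clique_complex V R) F"
  then have "F \<subseteq> V" "\<not> pairwise R F"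
    by (auto simp: minimal_nonface_def clique_complex_def)
  then obtain u v where uv: "u \<in> F" "v \<in> F" "u \<noteq> v" "\<not> R u v"
    by (auto simp: pairwise_def)
  then have "{u, v} \<notin> clique_complex V R" by (auto simp: clique_complex_def pairwise_def)
  moreover have "{u, v} \<subseteq> F" using uv by auto
  ultimately have "F = {u, v}" using F unfolding minimal_nonface_def by blast
  then show "card F = 2" using uv by simp
qed

text \<open>Transport along the injection \<open>to_nat\<close>: the complex found below has triples
  as vertices, whereas the theorem asks for one on natural numbers.\<close>

lemma flag_balanced_complex_nat_copy:
  fixes K :: "'a::countable set set"
  assumes "abstract_complex K" "flag_complex K" "balanced_complex K"
  shows "\<exists>K' :: nat set set. abstract_complex K' \<and> flag_complex K' \<and> balanced_complex K' \<and>
    f_polynomial K' = f_polynomial K"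
proof -
  define f :: "'a \<Rightarrow> nat" where "f = to_nat"
  have inj: "inj f" by (simp add: f_def)
  define K' where "K' = (`) f ` K"
  have mem: "f ` F \<in> K' \<longleftrightarrow> F \<in> K" for F
    unfolding K'_def using inj by (simp add: inj_image_mem_iff inj_image_eq_iff inj_def)
  have card: "card (f ` F) = card F" for F by (rule card_image[OF inj_on_subset[OF inj]]) simp
  have Un: "\<Union>K' = f ` \<Union>K" by (auto simp: K'_def)
  have fin: "finite K" using assms(1) by (simp add: abstract_complex_def)
  have rank: "complex_rank K' = complex_rank K"
    by (simp add: complex_rank_def K'_def image_image card)
  have "abstract_complex K'"
    unfolding abstract_complex_def
  proof (intro conjI ballI allI impI)
    show "finite K'" using fin by (simp add: K'_def)
    show "{} \<in> K'" using assms(1) mem[of "{}"] by (simp add: abstract_complex_def)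
  next
    fix F assume "F \<in> K'"
    then obtain F' where F': "F' \<in> K" "F = f ` F'" by (auto simp: K'_def)
    then show "finite F" using assms(1) by (simp add: abstract_complex_def)
    fix G assume "G \<subseteq> F"
    then obtain G' where "G' \<subseteq> F'" "G = f ` G'" using F' by (auto elim: subset_imageE)
    then show "G \<in> K'" using F' assms(1) mem by (auto simp: abstract_complex_def)
  qed
  moreover have "flag_complex K'"
    unfolding flag_complex_def
  proof (intro allI impI)
    fix F assume F: "minimal_nonface K' F"
    then obtain F' where F': "F' \<subseteq> \<Union>K" "F = f ` F'"
      unfolding minimal_nonface_def Un by (auto elim: subset_imageE)
    have "G \<in> K" if "G \<subset> F'" for G
    proof -
      have "f ` G \<subset> F" using that F' inj by (metis image_mono inj_image_eq_iff psubset_eq)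
      then have "f ` G \<in> K'" using F by (simp add: minimal_nonface_def)
      then show ?thesis by (simp only: mem)
    qed
    moreover have "F' \<notin> K" using F unfolding F'(2) by (simp add: minimal_nonface_def mem)
    ultimately have "minimal_nonface K F'" using F'(1) by (simp add: minimal_nonface_def)
    then show "card F = 2" using assms(2) F' card by (simp add: flag_complex_def)
  qed
  moreover have "balanced_complex K'"
  proof -
    obtain c :: "'a \<Rightarrow> nat" where c: "c ` \<Union>K \<subseteq> {..<complex_rank K}" "\<And>F. F \<in> K \<Longrightarrow> inj_on c F"
      using assms(3) by (auto simp: balanced_complex_def)
    have inv: "inv f (f x) = x" for x using inj by simp
    have "(c \<circ> inv f) ` \<Union>K' \<subseteq> {..<complex_rank K'}"
      using c(1) by (simp add: Un rank image_image inv)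
    moreover have "inj_on (c \<circ> inv f) F" if "F \<in> K'" for F
    proof -
      from that obtain G where "G \<in> K" "F = f ` G" by (auto simp: K'_def)
      then show ?thesis using c(2)[of G] by (simp add: inj_on_def inv) metis
    qed
    ultimately show ?thesis unfolding balanced_complex_def by blast
  qed
  moreover have "f_polynomial K' = f_polynomial K"
  proof -
    have "inj_on ((`) f) K" using inj by (auto simp: inj_on_def inj_image_eq_iff)
    then show ?thesis
      using fin by (simp add: f_polynomial_eq_sum_monom K'_def sum.reindex card)
  qed
  ultimately show ?thesis by blast
qed

section \<open>Increasing matchings between finite sets of numbers\<close>

definition rank_in :: "nat set \<Rightarrow> nat \<Rightarrow> nat" where
  "rank_in J s = card {x \<in> J. x < s}"

lemma rank_in_less_iff:
  assumes "finite J" "s \<in> J" "t \<in> J"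
  shows "rank_in J s < rank_in J t \<longleftrightarrow> s < t"
proof -
  have mono: "rank_in J s < rank_in J t" if "s \<in> J" "s < t" for s t
    unfolding rank_in_def using assms(1) that by (intro psubset_card_mono) auto
  show ?thesis using mono[of s t] mono[of t s] assms by (cases s t rule: linorder_cases) auto
qed

lemma rank_in_eq_iff:
  assumes "finite J" "s \<in> J" "t \<in> J"
  shows "rank_in J s = rank_in J t \<longleftrightarrow> s = t"
  using rank_in_less_iff[OF assms] rank_in_less_iff[OF assms(1,3,2)] by (metis linorder_less_linear less_irrefl)

lemma rank_in_image:
  assumes "finite J"
  shows "rank_in J ` J = {..<card J}"
proof (rule card_subset_eq)
  have "rank_in J s < card J" if "s \<in> J" for s
    unfolding rank_in_def using assms that by (intro psubset_card_mono) auto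
  then show "rank_in J ` J \<subseteq> {..<card J}" by auto
  have "inj_on (rank_in J) J" using assms by (auto simp: inj_on_def rank_in_eq_iff)
  then show "card (rank_in J ` J) = card {..<card J}" by (simp add: card_image)
qed simp

text \<open>For sets of equal size, the graph of the unique increasing bijection, which pairs
  elements at equal positions.\<close>

definition increasing_matching :: "nat set \<Rightarrow> nat set \<Rightarrow> (nat \<times> nat) set" where
  "increasing_matching J J' = {(s, w). s \<in> J \<and> w \<in> J' \<and> rank_in J s = rank_in J' w}"

definition strictly_comparable :: "nat \<times> nat \<Rightarrow> nat \<times> nat \<Rightarrow> bool" where
  "strictly_comparable p q \<longleftrightarrow> fst p < fst q \<and> snd p < snd q \<or> fst q < fst p \<and> snd q < snd p"

lemma increasing_matching_images:
  assumes "finite J" "finite J'" "card J = card J'"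
  shows "fst ` increasing_matching J J' = J" "snd ` increasing_matching J J' = J'"
proof -
  have "rank_in J ` J = rank_in J' ` J'" using assms by (simp add: rank_in_image)
  then have "\<forall>s\<in>J. \<exists>w\<in>J'. rank_in J s = rank_in J' w" "\<forall>w\<in>J'. \<exists>s\<in>J. rank_in J s = rank_in J' w"
    by (metis imageE imageI)+
  then have "J \<subseteq> fst ` increasing_matching J J'" "J' \<subseteq> snd ` increasing_matching J J'"
    unfolding increasing_matching_def by (fastforce simp: image_iff)+
  then show "fst ` increasing_matching J J' = J" "snd ` increasing_matching J J' = J'"
    by (auto simp: increasing_matching_def)
qed

lemma pairwise_increasing_matching:
  assumes "finite J" "finite J'"
  shows "pairwise strictly_comparable (increasing_matching J J')"
proof (rule pairwiseI)
  fix p q assume pq: "p \<in> increasing_matching J J'" "q \<in> increasing_matching J J'" "p \<noteq> q"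
  then have "fst p < fst q \<longleftrightarrow> snd p < snd q" "fst q < fst p \<longleftrightarrow> snd q < snd p" "fst p = fst q \<longleftrightarrow> snd p = snd q"
    using rank_in_less_iff[OF assms(1)] rank_in_less_iff[OF assms(2)]
      rank_in_eq_iff[OF assms(1)] rank_in_eq_iff[OF assms(2)]
    by (auto simp: increasing_matching_def) (metis+)
  then show "strictly_comparable p q"
    using pq(3) by (auto simp: strictly_comparable_def prod_eq_iff)
qed

lemma pairwise_strictly_comparableD:
  assumes "pairwise strictly_comparable M"
  shows "inj_on fst M" "inj_on snd M"
  using assms by (fastforce simp: pairwise_def strictly_comparable_def inj_on_def)+

text \<open>By comparability the pairs below \<open>p\<close> in the first coordinate are those
  below it in the second. Both projections are injective on \<open>M\<close>, so the two coordinates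
  of \<open>p\<close> have the same rank, and a chain is recovered from its two projections.\<close>

lemma increasing_matching_unique:
  assumes "finite M" "pairwise strictly_comparable M"
  shows "increasing_matching (fst ` M) (snd ` M) = M"
proof -
  note inj = pairwise_strictly_comparableD[OF assms(2)]
  have rank: "rank_in (fst ` M) (fst p) = rank_in (snd ` M) (snd p)" if "p \<in> M" for p
  proof -
    let ?D = "{q \<in> M. fst q < fst p}"
    have "{q \<in> M. snd q < snd p} = ?D"
      using assms(2) that unfolding pairwise_def strictly_comparable_def
      by (metis (no_types, lifting) less_asym' less_irrefl)
    moreover have "{x \<in> fst ` M. x < fst p} = fst ` ?D" by auto
    moreover have "{x \<in> snd ` M. x < snd p} = snd ` {q \<in> M. snd q < snd p}" by auto
    moreover have "card (fst ` ?D) = card ?D" "card (snd ` ?D) = card ?D"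
      by (auto intro!: card_image intro: inj_on_subset[OF inj(1)] inj_on_subset[OF inj(2)])
    ultimately show ?thesis by (simp add: rank_in_def)
  qed
  have "p \<in> M" if p: "p \<in> increasing_matching (fst ` M) (snd ` M)" for p
  proof -
    obtain q r where qr: "q \<in> M" "fst p = fst q" "r \<in> M" "snd p = snd r"
      using p by (auto simp: increasing_matching_def)
    have "rank_in (fst ` M) (fst p) = rank_in (snd ` M) (snd p)"
      using p by (auto simp: increasing_matching_def)
    then have "rank_in (snd ` M) (snd q) = rank_in (snd ` M) (snd r)"
      using rank[OF qr(1)] qr by simp
    then have "snd q = snd r" using rank_in_eq_iff[of "snd ` M"] assms(1) qr by auto
    then have "p = q" using qr by (simp add: prod_eq_iff)
    then show ?thesis using qr by simp
  qed
  moreover have "p \<in> increasing_matching (fst ` M) (snd ` M)" if "p \<in> M" for p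
    using rank[OF that] imageI[OF that, of fst] imageI[OF that, of snd]
    by (simp add: increasing_matching_def case_prod_beta)
  ultimately show ?thesis by blast
qed

definition disjoint_subset_pairs :: "'a set \<Rightarrow> nat \<Rightarrow> nat \<Rightarrow> ('a set \<times> 'a set) set" where
  "disjoint_subset_pairs X k l = {(J, L). J \<subseteq> X \<and> L \<subseteq> X \<and> J \<inter> L = {} \<and> card J = k \<and> card L = l}"

lemma finite_disjoint_subset_pairs: "finite X \<Longrightarrow> finite (disjoint_subset_pairs X k l)"
  by (rule finite_subset[of _ "Pow X \<times> Pow X"]) (auto simp: disjoint_subset_pairs_def)

text \<open>Choose the union \<open>J \<union> L\<close> first and then \<open>J\<close> inside
  it.\<close>

lemma card_disjoint_subset_pairs:
  assumes "finite X"
  shows "card (disjoint_subset_pairs X k l) = trinomial (card X) k l"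
proof -
  let ?U = "{U. U \<subseteq> X \<and> card U = k + l}"
  have fin: "finite U" if "U \<subseteq> X" for U using assms that by (rule finite_subset[rotated])
  have "bij_betw (\<lambda>(J, L). (J \<union> L, J)) (disjoint_subset_pairs X k l) (SIGMA U:?U. {J. J \<subseteq> U \<and> card J = k})"
    by (rule bij_betwI[where g = "\<lambda>(U, J). (J, U - J)"])
      (auto simp: disjoint_subset_pairs_def card_Un_disjoint card_Diff_subset fin)
  then have "card (disjoint_subset_pairs X k l) = card (SIGMA U:?U. {J. J \<subseteq> U \<and> card J = k})"
    by (rule bij_betw_same_card)
  also have "\<dots> = (\<Sum>U\<in>?U. card {J. J \<subseteq> U \<and> card J = k})"
    using assms fin by (intro card_SigmaI) auto
  also have "\<dots> = (\<Sum>U\<in>?U. (k + l) choose k)"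
    using fin by (intro sum.cong refl) (auto simp: n_subsets)
  also have "\<dots> = trinomial (card X) k l"
    using assms by (simp add: n_subsets trinomial_def)
  finally show ?thesis .
qed

text \<open>Chosen so that a clique is a pair of increasing matchings, one for each sign, whose
  supports are disjoint in both coordinates.\<close>

definition signed_compatible :: "nat \<times> nat \<times> bool \<Rightarrow> nat \<times> nat \<times> bool \<Rightarrow> bool" where
  "signed_compatible = (\<lambda>(s, w, e) (s', w', e'). s \<noteq> s' \<and> w \<noteq> w' \<and> (e = e' \<longrightarrow> (s < s' \<longleftrightarrow> w < w')))"

definition signed_matching_complex :: "nat \<Rightarrow> nat \<Rightarrow> (nat \<times> nat \<times> bool) set set" where
  "signed_matching_complex a b = clique_complex ({..<a} \<times> {..<b} \<times> UNIV) signed_compatible"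

definition sign_part :: "bool \<Rightarrow> (nat \<times> nat \<times> bool) set \<Rightarrow> (nat \<times> nat) set" where
  "sign_part e F = {(s, w). (s, w, e) \<in> F}"

lemma mem_sign_part: "p \<in> sign_part e F \<longleftrightarrow> (fst p, snd p, e) \<in> F"
  by (auto simp: sign_part_def)

lemma finite_sign_part: "finite F \<Longrightarrow> finite (sign_part e F)"
  by (rule finite_subset[of _ "(\<lambda>(s, w, e). (s, w)) ` F"]) (force simp: sign_part_def)+

lemma card_sign_part:
  assumes "finite F"
  shows "card F = card (sign_part True F) + card (sign_part False F)"
proof -
  let ?h = "\<lambda>e (s, w). (s, w, e)"
  have "F = ?h True ` sign_part True F \<union> ?h False ` sign_part False F"
  proof (rule set_eqI)
    fix u :: "nat \<times> nat \<times> bool"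
    obtain s w e where "u = (s, w, e)" by (cases u)
    then show "u \<in> F \<longleftrightarrow> u \<in> ?h True ` sign_part True F \<union> ?h False ` sign_part False F"
      by (cases e) (auto simp: sign_part_def)
  qed
  moreover have "?h True ` sign_part True F \<inter> ?h False ` sign_part False F = {}" by auto
  moreover have "card (?h e ` sign_part e F) = card (sign_part e F)" for e
    by (intro card_image) (auto simp: inj_on_def)
  ultimately show ?thesis
    using finite_sign_part[OF assms] by (metis card_Un_disjoint finite_imageI)
qed

text \<open>A face is determined by the supports of its two sign parts, since each part is the
  increasing matching of its projections. Keeping only the four supports is therefore a bijection
  onto the quadruples counted by \<open>gamma_coeff\<close>.\<close>

lemma card_faces_signed_matching_complex:
  "card {F \<in> signed_matching_complex a b. card F = n} = gamma_coeff a b n"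
proof -
  let ?A = "{F \<in> signed_matching_complex a b. card F = n}"
  let ?D = "\<lambda>k. disjoint_subset_pairs {..<a} k (n - k) \<times> disjoint_subset_pairs {..<b} k (n - k)"
  \<comment> \<open>\<open>\<phi>\<close> takes the four supports of a face, and
    \<open>\<psi>\<close> restores the matchings from them.\<close>
  define \<phi> where "\<phi> F = ((fst ` sign_part True F, fst ` sign_part False F),
     (snd ` sign_part True F, snd ` sign_part False F))" for F
  define \<psi> where "\<psi> = (\<lambda>((J, L), (J', L')). {(s, w, e). (s, w) \<in> (if e then increasing_matching J J' else increasing_matching L L')})"
  have finF: "finite F" if "F \<in> ?A" for F
    using that finite_subset[of F "{..<a} \<times> {..<b} \<times> UNIV"]
    by (auto simp: signed_matching_complex_def clique_complex_def)
  have chain: "pairwise strictly_comparable (sign_part e F)" if "F \<in> ?A" for e F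
    using that unfolding signed_matching_complex_def clique_complex_def
    by (fastforce simp: pairwise_def strictly_comparable_def signed_compatible_def sign_part_def)
  have "bij_betw \<phi> ?A (\<Union>k\<le>n. ?D k)"
  proof (rule bij_betwI[where g = \<psi>])
    show "\<phi> \<in> ?A \<rightarrow> (\<Union>k\<le>n. ?D k)"
    proof
      fix F assume F: "F \<in> ?A"
      note inj = pairwise_strictly_comparableD[OF chain[OF F]]
      let ?k = "card (sign_part True F)"
      have l: "card (sign_part False F) = n - ?k" and k: "?k \<le> n"
        using card_sign_part[OF finF[OF F]] F by auto
      have "F \<subseteq> {..<a} \<times> {..<b} \<times> UNIV" "pairwise signed_compatible F"
        using F by (auto simp: signed_matching_complex_def clique_complex_def)
      then have "fst ` sign_part e F \<subseteq> {..<a}" "snd ` sign_part e F \<subseteq> {..<b}"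
        "fst ` sign_part True F \<inter> fst ` sign_part False F = {}"
        "snd ` sign_part True F \<inter> snd ` sign_part False F = {}" for e
        by (force simp: sign_part_def pairwise_def signed_compatible_def)+
      then have "\<phi> F \<in> ?D ?k"
        using l by (auto simp: \<phi>_def disjoint_subset_pairs_def card_image inj)
      with k show "\<phi> F \<in> (\<Union>k\<le>n. ?D k)" by (intro UN_I) auto
    qed
    show "\<psi> \<in> (\<Union>k\<le>n. ?D k) \<rightarrow> ?A"
    proof
      fix x assume "x \<in> (\<Union>k\<le>n. ?D k)"
      then obtain k J L J' L' where k: "k \<le> n" and x: "x = ((J, L), (J', L'))"
        and JL: "J \<subseteq> {..<a}" "L \<subseteq> {..<a}" "J \<inter> L = {}" "card J = k" "card L = n - k"
        and JL': "J' \<subseteq> {..<b}" "L' \<subseteq> {..<b}" "J' \<inter> L' = {}" "card J' = k" "card L' = n - k"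
        by (auto simp: disjoint_subset_pairs_def)
      have fin: "finite J" "finite L" "finite J'" "finite L'"
        using JL JL' by (auto intro: finite_subset)
      have sp: "sign_part True (\<psi> x) = increasing_matching J J'" "sign_part False (\<psi> x) = increasing_matching L L'"
        by (auto simp: x \<psi>_def sign_part_def)
      have sub: "increasing_matching J J' \<subseteq> J \<times> J'" "increasing_matching L L' \<subseteq> L \<times> L'"
        by (auto simp: increasing_matching_def)
      have sub2: "\<psi> x \<subseteq> {..<a} \<times> {..<b} \<times> UNIV"
        using sub JL JL' by (auto simp: x \<psi>_def split: if_splits)
      have "pairwise signed_compatible (\<psi> x)"
      proof (rule pairwiseI)
        fix u v assume uv: "u \<in> \<psi> x" "v \<in> \<psi> x" "u \<noteq> v"
        obtain s w e s' w' e' where [simp]: "u = (s, w, e)" "v = (s', w', e')" by (cases u; cases v)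
        show "signed_compatible u v"
        proof (cases "e = e'")
          case True
          then have "(s, w) \<noteq> (s', w')" using uv by auto
          then have "strictly_comparable (s, w) (s', w')"
            using uv True pairwise_increasing_matching[OF fin(1,3)] pairwise_increasing_matching[OF fin(2,4)]
            by (auto simp: x \<psi>_def pairwise_def split: if_splits)
          then show ?thesis by (auto simp: strictly_comparable_def signed_compatible_def)
        next
          case False
          then show ?thesis
            using uv sub JL(3) JL'(3) by (auto simp: x \<psi>_def signed_compatible_def split: if_splits)
        qed
      qed
      moreover have "card (\<psi> x) = n"
      proof -
        have "finite (\<psi> x)" using sub2 by (rule finite_subset) auto
        moreover have "card (increasing_matching J J') = k"
          using increasing_matching_images[OF fin(1,3)] JL JL'
            card_image[OF pairwise_strictly_comparableD(1)[OF pairwise_increasing_matching[OF fin(1,3)]]] by simp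
        moreover have "card (increasing_matching L L') = n - k"
          using increasing_matching_images[OF fin(2,4)] JL JL'
            card_image[OF pairwise_strictly_comparableD(1)[OF pairwise_increasing_matching[OF fin(2,4)]]] by simp
        ultimately show ?thesis using k card_sign_part[of "\<psi> x"] sp by simp
      qed
      ultimately show "\<psi> x \<in> ?A"
        using sub2 by (auto simp: signed_matching_complex_def clique_complex_def)
    qed
    show "\<psi> (\<phi> F) = F" if "F \<in> ?A" for F
    proof (rule set_eqI)
      fix u :: "nat \<times> nat \<times> bool"
      obtain s w e where u: "u = (s, w, e)" by (cases u)
      show "u \<in> \<psi> (\<phi> F) \<longleftrightarrow> u \<in> F"
        using increasing_matching_unique[OF finite_sign_part[OF finF[OF that]] chain[OF that], of e]
        by (cases e) (simp_all add: u \<phi>_def \<psi>_def mem_sign_part)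
    qed
    show "\<phi> (\<psi> x) = x" if xB: "x \<in> (\<Union>k\<le>n. ?D k)" for x
    proof -
      obtain J L J' L' where x: "x = ((J, L), (J', L'))"
        and JL: "J \<subseteq> {..<a}" "L \<subseteq> {..<a}" "card J = card J'" 
        and JL': "J' \<subseteq> {..<b}" "L' \<subseteq> {..<b}" "card L = card L'"
        using xB by (auto simp: disjoint_subset_pairs_def)
      have fin: "finite J" "finite L" "finite J'" "finite L'"
        using JL JL' by (auto intro: finite_subset)
      have sp: "sign_part True (\<psi> x) = increasing_matching J J'" "sign_part False (\<psi> x) = increasing_matching L L'"
        by (auto simp: x \<psi>_def sign_part_def)
      show ?thesis
        unfolding \<phi>_def sp using fin JL JL' by (simp add: increasing_matching_images x)
    qed
  qed
  then have "card ?A = card (\<Union>k\<le>n. ?D k)" by (rule bij_betw_same_card)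
  also have "\<dots> = (\<Sum>k\<le>n. card (?D k))"
  proof (rule card_UN_disjoint)
    \<comment> \<open>The index \<open>k\<close> is recovered as the size of the set
      \<open>J\<close>.\<close>
    show "\<forall>i\<in>{..n}. \<forall>j\<in>{..n}. i \<noteq> j \<longrightarrow> ?D i \<inter> ?D j = {}"
      by (auto simp: disjoint_subset_pairs_def)
  qed (simp_all add: finite_disjoint_subset_pairs)
  also have "\<dots> = gamma_coeff a b n"
    by (simp add: card_cartesian_product card_disjoint_subset_pairs gamma_coeff_def)
  finally show ?thesis .
qed

lemma signed_matching_complex:
  assumes "a \<le> b"
  shows "abstract_complex (signed_matching_complex a b)" "flag_complex (signed_matching_complex a b)"
    "balanced_complex (signed_matching_complex a b)"
    "coeff (f_polynomial (signed_matching_complex a b)) n = int (gamma_coeff a b n)"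
    "degree (f_polynomial (signed_matching_complex a b)) \<le> a"
proof -
  let ?K = "signed_matching_complex a b"
  show abs: "abstract_complex ?K"
    unfolding signed_matching_complex_def by (rule abstract_complex_clique_complex) simp
  show "flag_complex ?K"
    unfolding signed_matching_complex_def by (rule flag_complex_clique_complex)
  have fin: "finite ?K" and ne: "{} \<in> ?K" using abs by (auto simp: abstract_complex_def)
  have inj: "inj_on fst F" if "F \<in> ?K" for F
    using that unfolding signed_matching_complex_def clique_complex_def
    by (fastforce simp: inj_on_def pairwise_def signed_compatible_def)
  \<comment> \<open>The positive diagonal, available because \<open>a <= b\<close>, is a face with
    \<open>a\<close> vertices. So at least \<open>a\<close> colors are allowed, enough for the
    coloring by the first coordinate.\<close>
  have "(\<lambda>s. (s, s, True)) ` {..<a} \<in> ?K"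
    using assms by (auto simp: signed_matching_complex_def clique_complex_def pairwise_def signed_compatible_def)
  then have "card ((\<lambda>s. (s, s, True)) ` {..<a}) \<le> complex_rank ?K"
    unfolding complex_rank_def using fin by (intro Max_ge) auto
  then have "a \<le> complex_rank ?K"
    by (subst (asm) card_image) (auto simp: inj_on_def)
  moreover have "fst ` \<Union>?K \<subseteq> {..<a}"
    by (auto simp: signed_matching_complex_def clique_complex_def)
  ultimately have "fst ` \<Union>?K \<subseteq> {..<complex_rank ?K}"
    by (meson lessThan_subset_iff order.trans)
  then show "balanced_complex ?K"
    unfolding balanced_complex_def using inj by blast
  show cf: "coeff (f_polynomial ?K) n = int (gamma_coeff a b n)" for n
  proof -
    have "coeff (f_polynomial ?K) n = (\<Sum>F\<in>?K. if card F = n then 1 else 0)"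
      using fin by (simp add: f_polynomial_eq_sum_monom coeff_sum)
    also have "\<dots> = int (card {F \<in> ?K. card F = n})"
      using fin by (simp add: sum.If_cases Int_def)
    finally show ?thesis by (simp add: card_faces_signed_matching_complex)
  qed
  show "degree (f_polynomial ?K) \<le> a"
    by (rule degree_le) (simp add: cf gamma_coeff_eq_0)
qed

section \<open>The polytope of a complete bipartite graph\<close>

definition abs_sum :: "'v set \<Rightarrow> real ^ 'v::finite \<Rightarrow> real" where
  "abs_sum X x = (\<Sum>i\<in>X. \<bar>x $ i\<bar>)"

definition bipartite_ball :: "'v set \<Rightarrow> 'v set \<Rightarrow> (real ^ 'v::finite) set" where
  "bipartite_ball A B = {x. (\<Sum>i\<in>UNIV. x $ i) = 0 \<and> abs_sum A x \<le> 1 \<and> abs_sum B x \<le> 1}"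

lemma abs_sum_nonneg: "0 \<le> abs_sum X x"
  by (simp add: abs_sum_def sum_nonneg)

lemma abs_sum_scaleR: "abs_sum X (c *\<^sub>R x) = \<bar>c\<bar> * abs_sum X x"
  by (simp add: abs_sum_def abs_mult sum_distrib_left)

lemma abs_sum_add_le: "abs_sum X (x + y) \<le> abs_sum X x + abs_sum X y"
  unfolding abs_sum_def sum.distrib[symmetric] by (rule sum_mono) (simp add: abs_triangle_ineq)

lemma abs_sum_convex_le:
  assumes "0 \<le> u" "0 \<le> v" "u + v = 1" "abs_sum X x \<le> 1" "abs_sum X y \<le> 1"
  shows "abs_sum X (u *\<^sub>R x + v *\<^sub>R y) \<le> 1"
proof -
  have "abs_sum X (u *\<^sub>R x + v *\<^sub>R y) \<le> u * abs_sum X x + v * abs_sum X y"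
    using abs_sum_add_le[of X "u *\<^sub>R x" "v *\<^sub>R y"] assms by (simp add: abs_sum_scaleR)
  also have "\<dots> \<le> u * 1 + v * 1" using assms by (intro add_mono mult_left_mono) auto
  finally show ?thesis using assms by simp
qed

lemma convex_bipartite_ball:
  fixes A B :: "'v::finite set"
  shows "convex (bipartite_ball A B)"
proof (rule convexI)
  fix x y :: "real ^ 'v" and u v :: real
  assume *: "x \<in> bipartite_ball A B" "y \<in> bipartite_ball A B" "0 \<le> u" "0 \<le> v" "u + v = 1"
  have "(\<Sum>i\<in>UNIV. (u *\<^sub>R x + v *\<^sub>R y) $ i) = u * (\<Sum>i\<in>UNIV. x $ i) + v * (\<Sum>i\<in>UNIV. y $ i)"
    by (simp add: sum.distrib sum_distrib_left)
  with * show "u *\<^sub>R x + v *\<^sub>R y \<in> bipartite_ball A B"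
    by (auto simp: bipartite_ball_def intro: abs_sum_convex_le)
qed

text \<open>Negative coefficients are absorbed by replacing \<open>y i\<close> by its negative.
  After division by their sum \<open>s\<close> the coefficients form a convex combination, which is
  then shrunk towards 0.\<close>

lemma convex_symmetric_sum:
  fixes C :: "'a::real_vector set"
  assumes "convex C" "0 \<in> C" "finite I" "(\<Sum>i\<in>I. \<bar>c i\<bar>) \<le> 1"
    and y: "\<And>i. i \<in> I \<Longrightarrow> y i \<in> C" "\<And>i. i \<in> I \<Longrightarrow> - y i \<in> C"
  shows "(\<Sum>i\<in>I. c i *\<^sub>R y i) \<in> C"
proof -
  define s where "s = (\<Sum>i\<in>I. \<bar>c i\<bar>)"
  show ?thesis
  proof (cases "s = 0")
    case True
    then have "\<forall>i\<in>I. c i = 0" using assms(3) by (simp add: s_def sum_nonneg_eq_0_iff)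
    then show ?thesis using assms(2) by simp
  next
    case False
    then have s: "0 < s" unfolding s_def by (metis abs_ge_zero less_eq_real_def sum_nonneg)
    have *: "(\<Sum>i\<in>I. (\<bar>c i\<bar> / s) *\<^sub>R (if c i < 0 then - y i else y i)) \<in> C"
      using s by (intro convex_sum[OF assms(3,1)]) (auto simp: sum_divide_distrib[symmetric] s_def y)
    have "(\<Sum>i\<in>I. c i *\<^sub>R y i) = s *\<^sub>R (\<Sum>i\<in>I. (\<bar>c i\<bar> / s) *\<^sub>R (if c i < 0 then - y i else y i)) + (1 - s) *\<^sub>R 0"
      using s by (auto simp: scaleR_sum_right intro!: sum.cong)
    also have "\<dots> \<in> C"
      using s assms(4) by (intro convexD[OF assms(1) * assms(2)]) (auto simp: s_def)
    finally show ?thesis .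
  qed
qed

lemma symmetric_edge_polytope_uminus:
  fixes x :: "real ^ 'v::finite"
  assumes "x \<in> symmetric_edge_polytope E"
  shows "- x \<in> symmetric_edge_polytope E"
proof -
  let ?G = "{axis v 1 - axis w (1::real) | v w. {v, w} \<in> E}"
  have "uminus ` ?G \<subseteq> ?G"
  proof clarify
    fix v w assume "{v, w} \<in> E"
    then have "{w, v} \<in> E" by (simp add: insert_commute)
    then show "\<exists>v' w'. - (axis v 1 - axis w (1::real)) = axis v' 1 - axis w' 1 \<and> {v', w'} \<in> E"
      by (intro exI[of _ w] exI[of _ v]) simp
  qed
  moreover have "linear (uminus :: real ^ 'v \<Rightarrow> _)" by (simp add: linear_iff)
  then have "uminus ` (convex hull ?G) = convex hull (uminus ` ?G)"
    by (rule convex_hull_linear_image)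
  ultimately have "uminus ` (convex hull ?G) \<subseteq> convex hull ?G" by (simp only: hull_mono)
  then show ?thesis using assms unfolding symmetric_edge_polytope_def by (meson image_subset_iff)
qed

text \<open>A transport argument: mass \<open>p\<close> moves along edges from \<open>A\<close> to
  \<open>B\<close> and mass \<open>q\<close> back, each by the product coupling. Row and column sums
  give the coordinates of \<open>x\<close>, and the total \<open>p + q\<close> bounds the absolute
  coefficients. The positive and negative parts need not have disjoint supports.\<close>

lemma bipartite_flow_in_polytope:
  fixes x :: "real ^ 'v::finite" and \<alpha>p \<alpha>m \<beta>p \<beta>m :: "'v \<Rightarrow> real"
  assumes AB: "A \<inter> B = {}" "A \<union> B = UNIV" "A \<noteq> {}" "B \<noteq> {}"
    and nonneg: "\<And>i. 0 \<le> \<alpha>p i" "\<And>i. 0 \<le> \<alpha>m i" "\<And>i. 0 \<le> \<beta>p i" "\<And>i. 0 \<le> \<beta>m i"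
    and sums: "sum \<alpha>p A = p" "sum \<beta>m B = p" "sum \<alpha>m A = q" "sum \<beta>p B = q" "p + q \<le> 1"
    and x: "\<And>i. i \<in> A \<Longrightarrow> x $ i = \<alpha>p i - \<alpha>m i" "\<And>i. i \<in> B \<Longrightarrow> x $ i = \<beta>p i - \<beta>m i"
  shows "x \<in> symmetric_edge_polytope (complete_bipartite_edges A B)" (is "_ \<in> ?P")
proof -
  \<comment> \<open>The net flow along an edge. If \<open>p\<close> or \<open>q\<close> is 0,
    division by zero gives 0, which is right because all masses involved vanish.\<close>
  define c where "c = (\<lambda>(v, w). \<alpha>p v * \<beta>m w / p - \<alpha>m v * \<beta>p w / q)"
  have edge: "axis v 1 - axis w 1 \<in> ?P" if "v \<in> A" "w \<in> B" for v w
    unfolding symmetric_edge_polytope_def complete_bipartite_edges_def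
    by (rule hull_inc) (use that in blast)
  have P: "convex ?P" by (simp add: symmetric_edge_polytope_def)
  obtain v0 w0 where vw0: "v0 \<in> A" "w0 \<in> B" using AB by blast
  have zero: "0 \<in> ?P"
    using convexD[OF P edge[OF vw0] symmetric_edge_polytope_uminus[OF edge[OF vw0]], of "1/2" "1/2"]
    by (simp only: scaleR_minus_right right_minus)
  have pq: "0 \<le> p" "0 \<le> q" using sums nonneg by (auto intro: sum_nonneg)
  have zp: "\<alpha>p v = 0" if "p = 0" "v \<in> A" for v
    using that sums(1) nonneg sum_nonneg_eq_0_iff[of A \<alpha>p] by simp
  have zq: "\<alpha>m v = 0" if "q = 0" "v \<in> A" for v
    using that sums(3) nonneg sum_nonneg_eq_0_iff[of A \<alpha>m] by simp
  have zp': "\<beta>m v = 0" if "p = 0" "v \<in> B" for v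
    using that sums(2) nonneg sum_nonneg_eq_0_iff[of B \<beta>m] by simp
  have zq': "\<beta>p v = 0" if "q = 0" "v \<in> B" for v
    using that sums(4) nonneg sum_nonneg_eq_0_iff[of B \<beta>p] by simp
  have rowA: "(\<Sum>w\<in>B. c (v, w)) = \<alpha>p v - \<alpha>m v" if "v \<in> A" for v
  proof -
    have "(\<Sum>w\<in>B. c (v, w)) = \<alpha>p v * sum \<beta>m B / p - \<alpha>m v * sum \<beta>p B / q"
      by (simp add: c_def sum_subtractf sum_distrib_left sum_divide_distrib)
    then show ?thesis using sums zp[of v] zq[of v] that by (cases "p = 0"; cases "q = 0") simp_all
  qed
  have rowB: "(\<Sum>v\<in>A. c (v, w)) = \<beta>m w - \<beta>p w" if "w \<in> B" for w
  proof -
    have "(\<Sum>v\<in>A. c (v, w)) = sum \<alpha>p A * \<beta>m w / p - sum \<alpha>m A * \<beta>p w / q"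
      by (simp add: c_def sum_subtractf sum_distrib_right sum_divide_distrib)
    then show ?thesis using sums zp'[of w] zq'[of w] that by (cases "p = 0"; cases "q = 0") simp_all
  qed
  have "(\<Sum>u\<in>A \<times> B. \<bar>c u\<bar>) \<le> (\<Sum>(v, w)\<in>A \<times> B. \<alpha>p v * \<beta>m w / p + \<alpha>m v * \<beta>p w / q)"
  proof (rule sum_mono)
    fix u :: "'v \<times> 'v"
    obtain v w where u: "u = (v, w)" by (cases u)
    have "0 \<le> \<alpha>p v * \<beta>m w / p" "0 \<le> \<alpha>m v * \<beta>p w / q" using nonneg pq by simp_all
    then show "\<bar>c u\<bar> \<le> (case u of (v, w) \<Rightarrow> \<alpha>p v * \<beta>m w / p + \<alpha>m v * \<beta>p w / q)"
      by (simp add: c_def u)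
  qed
  also have "\<dots> = sum \<alpha>p A * sum \<beta>m B / p + sum \<alpha>m A * sum \<beta>p B / q"
    by (simp add: sum.cartesian_product[symmetric] sum.distrib sum_product sum_divide_distrib)
  also have "\<dots> \<le> 1" using sums by (cases "p = 0"; cases "q = 0") simp_all
  finally have c: "(\<Sum>u\<in>A \<times> B. \<bar>c u\<bar>) \<le> 1" .
  have "x = (\<Sum>u\<in>A \<times> B. c u *\<^sub>R (axis (fst u) 1 - axis (snd u) 1))"
  proof (rule vec_eq_iff[THEN iffD2], rule allI)
    fix i
    have "(\<Sum>u\<in>A \<times> B. c u *\<^sub>R (axis (fst u) 1 - axis (snd u) 1)) $ i =
        (\<Sum>v\<in>A. \<Sum>w\<in>B. c (v, w) * ((if v = i then 1 else 0) - (if w = i then 1 else 0)))"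
      by (simp add: sum.cartesian_product axis_def case_prod_beta eq_commute[of i])
    also have "\<dots> = (\<Sum>v\<in>A. if v = i then \<Sum>w\<in>B. c (v, w) else 0) - (\<Sum>w\<in>B. if w = i then \<Sum>v\<in>A. c (v, w) else 0)"
    proof -
      have "(\<Sum>v\<in>A. \<Sum>w\<in>B. c (v, w) * (if w = i then 1 else 0)) = (\<Sum>w\<in>B. \<Sum>v\<in>A. c (v, w) * (if w = i then 1 else 0))"
        by (rule sum.swap)
      moreover have "(\<Sum>v\<in>A. \<Sum>w\<in>B. c (v, w) * (if v = i then 1 else 0)) = (\<Sum>v\<in>A. if v = i then \<Sum>w\<in>B. c (v, w) else 0)"
        "(\<Sum>w\<in>B. \<Sum>v\<in>A. c (v, w) * (if w = i then 1 else 0)) = (\<Sum>w\<in>B. if w = i then \<Sum>v\<in>A. c (v, w) else 0)"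
        by (rule sum.cong[OF refl], simp)+
      ultimately show ?thesis by (simp only: right_diff_distrib sum_subtractf)
    qed
    also have "\<dots> = x $ i"
    proof (cases "i \<in> A")
      case True
      then have "i \<notin> B" using AB by blast
      then show ?thesis using True by (simp add: rowA x)
    next
      case False
      then have "i \<in> B" using AB by blast
      then show ?thesis using False by (simp add: rowB x)
    qed
    finally show "x $ i = (\<Sum>u\<in>A \<times> B. c u *\<^sub>R (axis (fst u) 1 - axis (snd u) 1)) $ i" ..
  qed
  also have "\<dots> \<in> ?P"
    using edge symmetric_edge_polytope_uminus[OF edge]
    by (intro convex_symmetric_sum[OF P zero _ c]) auto
  finally show ?thesis .
qed

text \<open>Adding \<open>\<delta>\<close> to both the positive and the negative part at one vertex
  of \<open>B\<close> keeps the point and balances the transport, whose total mass is the norm on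
  \<open>A\<close>. The comparison of the two norms makes \<open>\<delta>\<close>
  nonnegative.\<close>

lemma bipartite_ball_subset_aux:
  fixes A B :: "'v::finite set"
  assumes AB: "A \<inter> B = {}" "A \<union> B = UNIV" "A \<noteq> {}" "B \<noteq> {}"
    and sum0: "(\<Sum>i\<in>UNIV. x $ i) = 0" and le: "abs_sum B x \<le> abs_sum A x" "abs_sum A x \<le> 1"
  shows "x \<in> symmetric_edge_polytope (complete_bipartite_edges A B)"
proof -
  define pos neg where "pos i = max 0 (x $ i)" and "neg i = max 0 (- (x $ i))" for i
  have pn: "x $ i = pos i - neg i" "\<bar>x $ i\<bar> = pos i + neg i" "0 \<le> pos i" "0 \<le> neg i" for i
    by (auto simp: pos_def neg_def max_def)
  obtain b where b: "b \<in> B" using AB by blast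
  \<comment> \<open>The surplus that has to be moved inside \<open>A\<close>; it is routed through the vertex \<open>b\<close>.\<close>
  define \<delta> where "\<delta> = sum pos A - sum neg B"
  have "(\<Sum>i\<in>UNIV. x $ i) = (\<Sum>i\<in>A. x $ i) + (\<Sum>i\<in>B. x $ i)"
    using AB by (simp add: sum.union_disjoint flip: AB(2))
  then have bal: "sum pos A - sum neg A + (sum pos B - sum neg B) = 0"
    using sum0 by (simp add: pn(1) sum_subtractf)
  have abs: "abs_sum X x = sum pos X + sum neg X" for X
    by (simp add: abs_sum_def pn(2) sum.distrib)
  have \<delta>: "0 \<le> \<delta>" "\<delta> = sum neg A - sum pos B"
    using bal le by (simp_all add: \<delta>_def abs)
  have pad: "(\<Sum>i\<in>B. f i + (if i = b then \<delta> else 0)) = sum f B + \<delta>" for f :: "'v \<Rightarrow> real"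
    using b by (simp add: sum.distrib)
  show ?thesis
  proof (rule bipartite_flow_in_polytope[OF AB])
    show "sum pos A = sum pos A" "sum neg A = sum neg A" by simp_all
    show "(\<Sum>i\<in>B. neg i + (if i = b then \<delta> else 0)) = sum pos A"
      unfolding pad by (simp add: \<delta>_def)
    show "(\<Sum>i\<in>B. pos i + (if i = b then \<delta> else 0)) = sum neg A"
      unfolding pad by (simp add: \<delta>(2))
    show "sum pos A + sum neg A \<le> 1" using le by (simp add: abs)
  qed (use pn \<delta> in auto)
qed

lemma complete_bipartite_edges_commute: "complete_bipartite_edges A B = complete_bipartite_edges B A"
  unfolding complete_bipartite_edges_def by (auto simp: insert_commute)

lemma symmetric_edge_polytope_complete_bipartite:
  fixes A B :: "'v::finite set"
  assumes AB: "A \<inter> B = {}" "A \<union> B = UNIV" "A \<noteq> {}" "B \<noteq> {}"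
  shows "symmetric_edge_polytope (complete_bipartite_edges A B) = bipartite_ball A B"
proof
  have edge: "axis v 1 - axis w 1 \<in> bipartite_ball A B" if "v \<in> A \<and> w \<in> B \<or> v \<in> B \<and> w \<in> A" for v w
  proof -
    have "v \<noteq> w" using that AB by blast
    have "(\<Sum>i\<in>UNIV. (axis v 1 - axis w (1::real)) $ i) = 0"
      by (simp add: sum_subtractf axis_def)
    moreover have "abs_sum X (axis v 1 - axis w 1) \<le> 1" if "v \<notin> X \<or> w \<notin> X" for X
    proof -
      have "abs_sum X (axis v 1 - axis w 1) = (\<Sum>i\<in>X. (if i = v then 1 else 0) + (if i = w then 1 else 0))"
        unfolding abs_sum_def using \<open>v \<noteq> w\<close> by (intro sum.cong) (auto simp: axis_def)
      also have "\<dots> \<le> 1" using that by (auto simp: sum.distrib)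
      finally show ?thesis .
    qed
    ultimately show ?thesis using that AB by (auto simp: bipartite_ball_def)
  qed
  then show "symmetric_edge_polytope (complete_bipartite_edges A B) \<subseteq> bipartite_ball A B"
    unfolding symmetric_edge_polytope_def
    by (intro hull_minimal convex_bipartite_ball) (auto simp: complete_bipartite_edges_def doubleton_eq_iff)
  show "bipartite_ball A B \<subseteq> symmetric_edge_polytope (complete_bipartite_edges A B)"
  proof
    fix x assume x: "x \<in> bipartite_ball A B"
    show "x \<in> symmetric_edge_polytope (complete_bipartite_edges A B)"
    proof (cases "abs_sum B x \<le> abs_sum A x")
      case True
      then show ?thesis using bipartite_ball_subset_aux[OF AB] x by (simp add: bipartite_ball_def)
    next
      case False
      moreover have "B \<inter> A = {}" "B \<union> A = UNIV" using AB by auto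
      ultimately show ?thesis
        using bipartite_ball_subset_aux[of B A x] AB x complete_bipartite_edges_commute[of A B]
        by (simp add: bipartite_ball_def)
    qed
  qed
qed

text \<open>Inside the hyperplane this is the unit ball of the norm \<open>?N\<close>, so its
  frontier is the unit sphere. The relative interior is found by extending segments from points of
  the ball slightly beyond \<open>x\<close>.\<close>

lemma rel_frontier_bipartite_ball:
  fixes A B :: "'v::finite set"
  shows "rel_frontier (bipartite_ball A B) = {x. (\<Sum>i\<in>UNIV. x $ i) = 0 \<and> max (abs_sum A x) (abs_sum B x) = 1}"
proof -
  let ?Q = "bipartite_ball A B"
  let ?N = "\<lambda>x. max (abs_sum A x) (abs_sum B x)"
  have mem: "x \<in> ?Q \<longleftrightarrow> (\<Sum>i\<in>UNIV. x $ i) = 0 \<and> ?N x \<le> 1" for x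
    by (auto simp: bipartite_ball_def)
  have sum_lin: "(\<Sum>i\<in>UNIV. (u *\<^sub>R x + v *\<^sub>R y) $ i) = u * (\<Sum>i\<in>UNIV. x $ i) + v * (\<Sum>i\<in>UNIV. y $ i)"
    for u v and x y :: "real ^ 'v"
    by (simp add: sum.distrib sum_distrib_left)
  have N_scale: "?N (c *\<^sub>R x) = \<bar>c\<bar> * ?N x" for c x
    by (simp add: abs_sum_scaleR max_mult_distrib_left)
  have N_add: "?N (x + y) \<le> ?N x + ?N y" for x y
    using abs_sum_add_le[of A x y] abs_sum_add_le[of B x y] by linarith
  have N_nonneg: "0 \<le> ?N x" for x using abs_sum_nonneg[of A x] by linarith
  have zero: "0 \<in> ?Q" by (simp add: mem abs_sum_def)
  have closed: "closed ?Q"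
    unfolding bipartite_ball_def abs_sum_def
    by (intro closed_Collect_conj closed_Collect_eq closed_Collect_le continuous_intros)
  have int: "x \<in> rel_interior ?Q \<longleftrightarrow> (\<Sum>i\<in>UNIV. x $ i) = 0 \<and> ?N x < 1" for x
  proof -
    have "x \<in> rel_interior ?Q \<longleftrightarrow> (\<forall>y\<in>?Q. \<exists>e>1. (1 - e) *\<^sub>R y + e *\<^sub>R x \<in> ?Q)"
      using zero by (intro convex_rel_interior_iff convex_bipartite_ball) auto
    also have "\<dots> \<longleftrightarrow> (\<Sum>i\<in>UNIV. x $ i) = 0 \<and> ?N x < 1"
    proof
      assume "\<forall>y\<in>?Q. \<exists>e>1. (1 - e) *\<^sub>R y + e *\<^sub>R x \<in> ?Q"
      \<comment> \<open>Taking the segment that starts at 0 shows that a proper multiple of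
        \<open>x\<close> still lies in the ball.\<close>
      then obtain e where e: "e > 1" "e *\<^sub>R x \<in> ?Q" using zero by force
      then have "e * (\<Sum>i\<in>UNIV. x $ i) = 0" "e * ?N x \<le> 1"
        using N_scale[of e x] by (auto simp: mem sum_distrib_left)
      moreover have "?N x < 1"
      proof (rule ccontr)
        assume "\<not> ?N x < 1"
        then have "e * 1 \<le> e * ?N x" using e(1) by (intro mult_left_mono) auto
        then show False using \<open>e * ?N x \<le> 1\<close> e(1) by linarith
      qed
      ultimately show "(\<Sum>i\<in>UNIV. x $ i) = 0 \<and> ?N x < 1" using e(1) by auto
    next
      assume x: "(\<Sum>i\<in>UNIV. x $ i) = 0 \<and> ?N x < 1"
      \<comment> \<open>With n = \<open>?N x\<close> the bound obtained below is 1 - (1 - n)^2 / 2,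
        which is at most 1.\<close>
      define e where "e = 1 + (1 - ?N x) / 2"
      have e: "e > 1" using x by (simp add: e_def)
      show "\<forall>y\<in>?Q. \<exists>e>1. (1 - e) *\<^sub>R y + e *\<^sub>R x \<in> ?Q"
      proof
        fix y assume y: "y \<in> ?Q"
        have "?N ((1 - e) *\<^sub>R y + e *\<^sub>R x) \<le> (e - 1) * ?N y + e * ?N x"
          using N_add[of "(1 - e) *\<^sub>R y" "e *\<^sub>R x"] e N_scale[of "1 - e" y] N_scale[of e x] by simp
        also have "\<dots> \<le> (e - 1) * 1 + e * ?N x"
          using e y by (intro add_mono mult_left_mono) (auto simp: mem)
        also have "\<dots> \<le> 1"
        proof -
          define n where "n = ?N x"
          have "0 \<le> (1 - n) * (1 - n)" by simp
          then have "(1 - n) / 2 + (1 + (1 - n) / 2) * n \<le> 1" by (simp add: field_simps)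
          then show ?thesis by (simp add: e_def n_def)
        qed
        finally have "(1 - e) *\<^sub>R y + e *\<^sub>R x \<in> ?Q"
          using x y unfolding mem sum_lin by simp
        with e show "\<exists>e>1. (1 - e) *\<^sub>R y + e *\<^sub>R x \<in> ?Q" by blast
      qed
    qed
    finally show ?thesis .
  qed
  have "(s = 0 \<and> n \<le> 1) \<and> \<not> (s = 0 \<and> n < 1) \<longleftrightarrow> s = 0 \<and> n = 1" for s n :: real
    by linarith
  then show ?thesis
    unfolding rel_frontier_def closure_closed[OF closed] set_eq_iff Diff_iff int mem mem_Collect_eq
    by blast
qed

section \<open>Lattice points in unimodular complexes\<close>

text \<open>Functions are extensional outside \<open>C\<close>, so that distinct elements differ as
  compositions and the set is finite.\<close>

definition positive_compositions :: "'b set \<Rightarrow> nat \<Rightarrow> ('b \<Rightarrow> nat) set" where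
  "positive_compositions C m = {c \<in> C \<rightarrow>\<^sub>E {0<..}. sum c C = m}"

lemma finite_positive_compositions:
  assumes "finite C"
  shows "finite (positive_compositions C m)"
proof (rule finite_subset)
  show "positive_compositions C m \<subseteq> C \<rightarrow>\<^sub>E {..m}"
  proof
    fix c assume c: "c \<in> positive_compositions C m"
    then have "c v \<le> m" if "v \<in> C" for v
      using member_le_sum[OF that, of c] assms by (simp add: positive_compositions_def)
    with c show "c \<in> C \<rightarrow>\<^sub>E {..m}" by (auto simp: positive_compositions_def PiE_iff)
  qed
qed (use assms in \<open>auto intro: finite_PiE\<close>)

lemma card_positive_compositions_insert:
  assumes "finite C" "v \<notin> C"
  shows "card (positive_compositions (insert v C) m) = (\<Sum>k\<in>{0<..m}. card (positive_compositions C (m - k)))"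
proof -
  have sum_upd: "sum (c(v := k)) C = sum c C" for c and k :: nat
    using assms(2) by (intro sum.cong) auto
  have "bij_betw (\<lambda>(k, c). c(v := k)) (SIGMA k:{0<..m}. positive_compositions C (m - k))
      (positive_compositions (insert v C) m)"
  proof (rule bij_betwI[where g = "\<lambda>c. (c v, restrict c C)"])
    show "(\<lambda>(k, c). c(v := k)) \<in> (SIGMA k:{0<..m}. positive_compositions C (m - k)) \<rightarrow>
        positive_compositions (insert v C) m"
      using assms sum_upd by (auto simp: positive_compositions_def PiE_iff extensional_def)
    show "(\<lambda>c. (c v, restrict c C)) \<in> positive_compositions (insert v C) m \<rightarrow>
        (SIGMA k:{0<..m}. positive_compositions C (m - k))"
      using assms by (auto simp: positive_compositions_def PiE_iff)
    show "(\<lambda>c. (c v, restrict c C)) ((\<lambda>(k, c). c(v := k)) x) = x"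
      if x: "x \<in> (SIGMA k:{0<..m}. positive_compositions C (m - k))" for x
    proof -
      obtain k c where "x = (k, c)" "c \<in> extensional C"
        using x by (auto simp: positive_compositions_def PiE_iff)
      then show ?thesis using assms by (auto simp: fun_eq_iff restrict_def extensional_def)
    qed
    show "(\<lambda>(k, c). c(v := k)) ((\<lambda>c. (c v, restrict c C)) c) = c"
      if "c \<in> positive_compositions (insert v C) m" for c
      using that by (auto simp: positive_compositions_def PiE_iff fun_eq_iff restrict_def extensional_def)
  qed
  then show ?thesis
    using assms by (simp add: bij_betw_same_card[symmetric] card_SigmaI finite_positive_compositions)
qed

text \<open>Each part contributes a factor z + z^2 + ... = w.\<close>

lemma card_positive_compositions:
  assumes "finite C"
  shows "int (card (positive_compositions C m)) = fps_nth (geo_tail ^ card C) m"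
  using assms
proof (induction C arbitrary: m rule: finite_induct)
  case empty
  show ?case by (auto simp: positive_compositions_def)
next
  case (insert v C)
  have "fps_nth (geo_tail ^ card (insert v C)) m = (\<Sum>k\<in>{0..m}. fps_nth geo_tail k * fps_nth (geo_tail ^ card C) (m - k))"
    using insert by (simp add: fps_mult_nth)
  also have "\<dots> = (\<Sum>k\<in>{0<..m}. fps_nth (geo_tail ^ card C) (m - k))"
    by (intro sum.mono_neutral_cong_right) auto
  also have "\<dots> = int (card (positive_compositions (insert v C) m))"
    using insert by (simp add: card_positive_compositions_insert)
  finally show ?case ..
qed

section \<open>Lattice points of dilated unimodular simplices\<close>

lemma integer_lattice_sum:
  "(\<And>v. v \<in> C \<Longrightarrow> v \<in> integer_lattice) \<Longrightarrow> (\<Sum>v\<in>C. of_int (c v) *\<^sub>R v) \<in> integer_lattice"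
  by (auto simp: integer_lattice_def)

lemma affine_independent_sum_cancel:
  fixes C :: "'a::real_vector set"
  assumes "finite C" "\<not> affine_dependent C" "sum f C = sum g C"
    and "(\<Sum>v\<in>C. f v *\<^sub>R v) = (\<Sum>v\<in>C. g v *\<^sub>R v)" "v \<in> C"
  shows "f v = g v"
proof (rule ccontr)
  assume "f v \<noteq> g v"
  then have "(\<exists>v\<in>C. f v - g v \<noteq> 0)" using assms(5) by auto
  moreover have "(\<Sum>v\<in>C. f v - g v) = 0" "(\<Sum>v\<in>C. (f v - g v) *\<^sub>R v) = 0"
    using assms(3,4) by (simp_all add: sum_subtractf scaleR_left_diff_distrib)
  ultimately show False
    using assms(1,2) by (auto simp: affine_dependent_explicit_finite)
qed

lemma simplex_vertices_of:
  assumes "n simplex S"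
  shows "finite (vertices_of S)" "\<not> affine_dependent (vertices_of S)" "convex hull (vertices_of S) = S"
proof -
  obtain C where C: "\<not> affine_dependent C" "S = convex hull C"
    using assms by (auto simp: simplex_def)
  then have "vertices_of S = C"
    by (simp add: vertices_of_def extreme_point_of_convex_hull_affine_independent)
  then show "finite (vertices_of S)" "\<not> affine_dependent (vertices_of S)" "convex hull (vertices_of S) = S"
    using C by (simp_all add: aff_independent_finite)
qed

text \<open>The dilate by \<open>m\<close> of a point in the relative interior has barycentric coordinates adding up to
  \<open>m\<close>; by unimodularity they are integers when the dilate is a lattice point.\<close>

lemma bij_betw_unimodular_simplex_lattice_points:
  fixes S :: "(real ^ 'v::finite) set"
  assumes S: "unimodular_lattice_simplex S" and "0 < m"
  shows "bij_betw (\<lambda>c. \<Sum>v\<in>vertices_of S. real (c v) *\<^sub>R v) (positive_compositions (vertices_of S) m)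
    {z \<in> integer_lattice. (1 / real m) *\<^sub>R z \<in> rel_interior S}"
proof -
  let ?C = "vertices_of S"
  obtain n where "n simplex S" using S by (auto simp: unimodular_lattice_simplex_def)
  note C = simplex_vertices_of[OF this]
  have lat: "v \<in> integer_lattice" if "v \<in> ?C" for v
    using S that by (auto simp: unimodular_lattice_simplex_def)
  have span: "integer_affine_span ?C = integer_lattice \<inter> affine hull ?C"
    using S C(3) affine_hull_convex_hull[of ?C] by (simp add: unimodular_lattice_simplex_def)
  have int: "rel_interior S = {y. \<exists>u. (\<forall>x\<in>?C. 0 < u x) \<and> sum u ?C = 1 \<and> (\<Sum>x\<in>?C. u x *\<^sub>R x) = y}"
    using rel_interior_convex_hull_explicit[OF C(2)] C(3) by simp
  show ?thesis
  proof (rule bij_betw_imageI)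
    show "inj_on (\<lambda>c. \<Sum>v\<in>?C. real (c v) *\<^sub>R v) (positive_compositions ?C m)"
    proof (rule inj_onI)
      fix c d assume cd: "c \<in> positive_compositions ?C m" "d \<in> positive_compositions ?C m"
        "(\<Sum>v\<in>?C. real (c v) *\<^sub>R v) = (\<Sum>v\<in>?C. real (d v) *\<^sub>R v)"
      have "(\<Sum>v\<in>?C. real (c v)) = (\<Sum>v\<in>?C. real (d v))"
        using cd(1,2) by (simp add: positive_compositions_def flip: of_nat_sum)
      then have "c v = d v" if "v \<in> ?C" for v
        using affine_independent_sum_cancel[OF C(1,2) _ cd(3) that] by simp
      then show "c = d"
        using cd(1,2) by (intro PiE_ext[of c ?C]) (auto simp: positive_compositions_def)
    qed
    show "(\<lambda>c. \<Sum>v\<in>?C. real (c v) *\<^sub>R v) ` positive_compositions ?C m =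
      {z \<in> integer_lattice. (1 / real m) *\<^sub>R z \<in> rel_interior S}"
    proof (intro equalityI subsetI)
      fix z assume "z \<in> (\<lambda>c. \<Sum>v\<in>?C. real (c v) *\<^sub>R v) ` positive_compositions ?C m"
      then obtain c where c: "c \<in> positive_compositions ?C m" "z = (\<Sum>v\<in>?C. real (c v) *\<^sub>R v)" by auto
      have "z \<in> integer_lattice"
        using integer_lattice_sum[of ?C "\<lambda>v. int (c v)"] lat by (simp add: c(2))
      moreover have "(\<Sum>v\<in>?C. real (c v) / real m) = 1"
        using c(1) assms(2) by (simp add: positive_compositions_def flip: of_nat_sum sum_divide_distrib)
      moreover have "\<forall>v\<in>?C. 0 < real (c v) / real m"
        using c(1) assms(2) by (auto simp: positive_compositions_def PiE_iff)
      moreover have "(\<Sum>v\<in>?C. (real (c v) / real m) *\<^sub>R v) = (1 / real m) *\<^sub>R z"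
        by (simp add: c(2) scaleR_sum_right)
      ultimately show "z \<in> {z \<in> integer_lattice. (1 / real m) *\<^sub>R z \<in> rel_interior S}"
        unfolding int by (intro CollectI conjI exI[of _ "\<lambda>v. real (c v) / real m"])
    next
      fix z assume z: "z \<in> {z \<in> integer_lattice. (1 / real m) *\<^sub>R z \<in> rel_interior S}"
      then obtain u where u: "\<forall>x\<in>?C. 0 < u x" "sum u ?C = 1" "(\<Sum>x\<in>?C. u x *\<^sub>R x) = (1 / real m) *\<^sub>R z"
        unfolding int by auto
      then obtain v0 where v0: "v0 \<in> ?C" by fastforce
      \<comment> \<open>Subtracting \<open>m - 1\<close> copies of the vertex \<open>v0\<close>
        lowers the coordinate sum from \<open>m\<close> to 1. The resulting lattice point lies in
        the affine hull, where unimodularity applies.\<close>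
      define e where "e v = (if v = v0 then m - 1 else 0)" for v
      define w where "w v = real m * u v - real (e v)" for v
      have e: "(\<Sum>v\<in>?C. real (e v)) = real (m - 1)" "(\<Sum>v\<in>?C. real (e v) *\<^sub>R v) = real (m - 1) *\<^sub>R v0"
        using C(1) v0 by (simp_all add: e_def if_distrib[of real] if_distrib[of "\<lambda>r. r *\<^sub>R _"] cong: if_cong)
      have w1: "sum w ?C = 1"
        using u(2) e(1) assms(2) by (simp add: w_def sum_subtractf of_nat_diff flip: sum_distrib_left)
      have w2: "(\<Sum>v\<in>?C. w v *\<^sub>R v) = z - real (m - 1) *\<^sub>R v0"
      proof -
        have "(\<Sum>v\<in>?C. w v *\<^sub>R v) = real m *\<^sub>R (\<Sum>v\<in>?C. u v *\<^sub>R v) - (\<Sum>v\<in>?C. real (e v) *\<^sub>R v)"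
          by (simp add: w_def scaleR_left_diff_distrib sum_subtractf scaleR_sum_right)
        then show ?thesis using u(3) e(2) assms(2) by simp
      qed
      have "(\<Sum>v\<in>?C. w v *\<^sub>R v) \<in> affine hull ?C"
        using w1 by (auto simp: affine_hull_finite[OF C(1)])
      moreover have "z - real (m - 1) *\<^sub>R v0 \<in> integer_lattice"
        using z lat[OF v0] by (auto simp: integer_lattice_def)
      ultimately have "(\<Sum>v\<in>?C. w v *\<^sub>R v) \<in> integer_affine_span ?C" using span w2 by simp
      then obtain d :: "_ \<Rightarrow> int" where d: "(\<Sum>v\<in>?C. w v *\<^sub>R v) = (\<Sum>v\<in>?C. of_int (d v) *\<^sub>R v)" "sum d ?C = 1"
        by (auto simp: integer_affine_span_def)
      have "(\<Sum>v\<in>?C. real_of_int (d v)) = 1" using d(2) by (metis of_int_1 of_int_sum)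
      then have wd: "w v = of_int (d v)" if "v \<in> ?C" for v
        using affine_independent_sum_cancel[OF C(1,2) _ d(1) that] w1 by simp
      \<comment> \<open>Adding \<open>e\<close> back gives \<open>real m * u v\<close>, a positive
        integer, so \<open>nat\<close> loses nothing.\<close>
      define c where "c = restrict (\<lambda>v. nat (d v + int (e v))) ?C"
      have c: "real (c v) = real m * u v" "0 < c v" if "v \<in> ?C" for v
      proof -
        have "0 < real m * u v" using u(1) that assms(2) by simp
        moreover have "real m * u v = real_of_int (d v + int (e v))" using wd[OF that] by (simp add: w_def)
        ultimately show "real (c v) = real m * u v" "0 < c v" using that by (auto simp: c_def)
      qed
      have "real (sum c ?C) = real m" using c(1) u(2) by (simp flip: sum_distrib_left)
      then have "sum c ?C = m" by (simp only: of_nat_eq_iff)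
      moreover have "c \<in> ?C \<rightarrow>\<^sub>E {0<..}"
        using c(2) by (simp add: PiE_iff) (simp add: c_def)
      ultimately have "c \<in> positive_compositions ?C m"
        by (simp add: positive_compositions_def)
      moreover have "(\<Sum>v\<in>?C. real (c v) *\<^sub>R v) = real m *\<^sub>R (\<Sum>v\<in>?C. u v *\<^sub>R v)"
        using c(1) by (simp add: scaleR_sum_right)
      then have "(\<Sum>v\<in>?C. real (c v) *\<^sub>R v) = z" using u(3) assms(2) by simp
      ultimately show "z \<in> (\<lambda>c. \<Sum>v\<in>?C. real (c v) *\<^sub>R v) ` positive_compositions ?C m" by blast
    qed
  qed
qed

text \<open>A point lies in the relative interior of a minimal simplex containing it, since
  otherwise a proper face would contain it.\<close>

lemma simplicial_complex_rel_interior_cover: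
  fixes T :: "'a::euclidean_space set set"
  assumes T: "simplicial_complex T"
  shows "\<Union>T = (\<Union>S\<in>T. rel_interior S)"
proof
  show "(\<Union>S\<in>T. rel_interior S) \<subseteq> \<Union>T" using rel_interior_subset by blast
  show "\<Union>T \<subseteq> (\<Union>S\<in>T. rel_interior S)"
  proof
    fix x assume "x \<in> \<Union>T"
    then have "{S\<in>T. x \<in> S} \<noteq> {}" "finite {S\<in>T. x \<in> S}" using T by (auto simp: simplicial_complex_def)
    then obtain S where S: "S \<in> T" "x \<in> S" "\<And>S'. S' \<in> T \<Longrightarrow> x \<in> S' \<Longrightarrow> S' \<subseteq> S \<Longrightarrow> S' = S"
      using finite_has_minimal[of "{S\<in>T. x \<in> S}"] by blast
    obtain n where "n simplex S" using T S(1) by (auto simp: simplicial_complex_def)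
    then have poly: "polyhedron S" by (rule simplex_imp_polyhedron)
    have "x \<in> rel_interior S"
    proof (rule ccontr)
      assume "x \<notin> rel_interior S"
      then have "x \<in> rel_frontier S"
        using S(2) closure_subset by (auto simp: rel_frontier_def)
      then obtain F where F: "F face_of S" "F \<noteq> S" "x \<in> F"
        by (auto simp: rel_frontier_of_polyhedron_alt[OF poly])
      then have "F \<in> T" "F \<subseteq> S" using T S(1) by (auto simp: simplicial_complex_def dest: face_of_imp_subset)
      then show False using S(3) F by blast
    qed
    then show "x \<in> (\<Union>S\<in>T. rel_interior S)" using S(1) by blast
  qed
qed

text \<open>The intersection is a face of both simplices, and a face that meets the relative
  interior is the whole simplex.\<close>

lemma simplicial_complex_rel_interior_disjoint:
  assumes T: "simplicial_complex T" and S: "S \<in> T" "S' \<in> T" "S \<noteq> S'"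
  shows "rel_interior S \<inter> rel_interior S' = {}"
proof (rule ccontr)
  assume "rel_interior S \<inter> rel_interior S' \<noteq> {}"
  then obtain x where x: "x \<in> rel_interior S" "x \<in> rel_interior S'" by blast
  then have "x \<in> S \<inter> S'" using rel_interior_subset by blast
  moreover have "S \<inter> S' face_of S" "S \<inter> S' face_of S'"
    using T S by (metis simplicial_complex_def inf_commute)+
  ultimately have "S \<inter> S' = S" "S \<inter> S' = S'"
    using face_of_disjoint_rel_interior x by blast+
  then show False using S(3) by simp
qed

lemma inj_on_vertices_of:
  assumes "simplicial_complex T"
  shows "inj_on vertices_of T"
  using assms simplex_vertices_of(3) unfolding simplicial_complex_def inj_on_def by metis

text \<open>The relative interiors partition the union, and a simplex with i vertices contributes
  w^i. For \<open>m > 0\<close> the empty simplex adds 0 on both sides.\<close>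

lemma card_lattice_points_unimodular_complex:
  fixes T :: "(real ^ 'v::finite) set set"
  assumes T: "simplicial_complex T" and uni: "\<forall>S\<in>T. unimodular_lattice_simplex S" and "0 < m"
  shows "int (card {z \<in> integer_lattice. (1 / real m) *\<^sub>R z \<in> \<Union>T}) =
    fps_nth (\<Sum>F\<in>vertex_scheme T. geo_tail ^ card F) m"
proof -
  let ?Z = "\<lambda>S. {z \<in> integer_lattice. (1 / real m) *\<^sub>R z \<in> rel_interior S}"
  have finT: "finite T" using T by (simp add: simplicial_complex_def)
  have finC: "finite (vertices_of S)" if "S \<in> T" for S
    using T that simplex_vertices_of(1) unfolding simplicial_complex_def by blast
  have card: "card (?Z S) = card (positive_compositions (vertices_of S) m)" "finite (?Z S)" if "S \<in> T" for S
  proof -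
    from bij_betw_unimodular_simplex_lattice_points[of S m] uni that assms(3)
    have bij: "bij_betw (\<lambda>c. \<Sum>v\<in>vertices_of S. real (c v) *\<^sub>R v) (positive_compositions (vertices_of S) m) (?Z S)"
      by blast
    then show "card (?Z S) = card (positive_compositions (vertices_of S) m)"
      by (rule bij_betw_same_card[symmetric])
    show "finite (?Z S)"
      using bij_betw_finite[OF bij] finite_positive_compositions[OF finC[OF that]] by simp
  qed
  have "{z \<in> integer_lattice. (1 / real m) *\<^sub>R z \<in> \<Union>T} = (\<Union>S\<in>T. ?Z S)"
    unfolding simplicial_complex_rel_interior_cover[OF T] by blast
  moreover have "card (\<Union>S\<in>T. ?Z S) = (\<Sum>S\<in>T. card (?Z S))"
  proof (rule card_UN_disjoint)
    show "\<forall>S\<in>T. \<forall>S'\<in>T. S \<noteq> S' \<longrightarrow> ?Z S \<inter> ?Z S' = {}"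
      using simplicial_complex_rel_interior_disjoint[OF T] by fast
  qed (use finT card(2) in auto)
  ultimately have "card {z \<in> integer_lattice. (1 / real m) *\<^sub>R z \<in> \<Union>T} = (\<Sum>S\<in>T. card (?Z S))"
    by (simp only:)
  then have "int (card {z \<in> integer_lattice. (1 / real m) *\<^sub>R z \<in> \<Union>T}) = (\<Sum>S\<in>T. fps_nth (geo_tail ^ card (vertices_of S)) m)"
    using card(1) finC by (simp add: card_positive_compositions)
  also have "\<dots> = fps_nth (\<Sum>F\<in>vertex_scheme T. geo_tail ^ card F) m"
    unfolding vertex_scheme_def sum.reindex[OF inj_on_vertices_of[OF T]] fps_sum_nth by simp
  finally show ?thesis .
qed

text \<open>The lattice point count needs \<open>m > 0\<close>, so the constant term is found
  separately: w has none, hence only the empty face contributes.\<close>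

lemma vertex_scheme_series_0:
  fixes T :: "(real ^ 'v::finite) set set"
  assumes T: "simplicial_complex T" "T \<noteq> {}"
  shows "{} \<in> vertex_scheme T" "finite (vertex_scheme T)"
    "fps_nth (\<Sum>F\<in>vertex_scheme T. geo_tail ^ card F) 0 = 1"
proof -
  obtain S where "S \<in> T" using T(2) by blast
  then have "{} \<in> T" using T(1) empty_face_of unfolding simplicial_complex_def by blast
  moreover have "vertices_of ({} :: (real ^ 'v) set) = {}" by (simp add: vertices_of_def extreme_point_of_def)
  ultimately show 0: "{} \<in> vertex_scheme T" unfolding vertex_scheme_def by (metis imageI)
  show fin: "finite (vertex_scheme T)" using T(1) by (simp add: vertex_scheme_def simplicial_complex_def)
  have "finite F" if "F \<in> vertex_scheme T" for F
    using T(1) that simplex_vertices_of(1) unfolding vertex_scheme_def simplicial_complex_def by blast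
  then have "fps_nth (geo_tail ^ card F) 0 = (if F = {} then 1 else 0)" if "F \<in> vertex_scheme T" for F
    using that by (auto simp: fps_nth_power_0 card_gt_0_iff)
  then have "fps_nth (\<Sum>F\<in>vertex_scheme T. geo_tail ^ card F) 0 = (\<Sum>F\<in>vertex_scheme T. if F = {} then 1 else 0)"
    by (simp add: fps_sum_nth)
  also have "\<dots> = 1" using 0 fin by simp
  finally show "fps_nth (\<Sum>F\<in>vertex_scheme T. geo_tail ^ card F) 0 = 1" .
qed

section \<open>Counting lattice points by their norms\<close>

definition int_ball :: "'b set \<Rightarrow> int \<Rightarrow> nat \<Rightarrow> ('b \<Rightarrow> int) set" where
  "int_ball X k m = {x \<in> X \<rightarrow>\<^sub>E UNIV. sum x X = k \<and> (\<Sum>v\<in>X. \<bar>x v\<bar>) \<le> int m}"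

definition int_quadrant :: "'b set \<Rightarrow> nat \<Rightarrow> nat \<Rightarrow> ('b \<Rightarrow> int) set" where
  "int_quadrant X p q = {x \<in> X \<rightarrow>\<^sub>E UNIV. (\<Sum>v\<in>X. max 0 (x v)) \<le> int p \<and> (\<Sum>v\<in>X. max 0 (- x v)) \<le> int q}"

lemma finite_bounded_int_functions:
  assumes "finite X"
  shows "finite {x \<in> X \<rightarrow>\<^sub>E UNIV. (\<Sum>v\<in>X. \<bar>x v\<bar>) \<le> (m :: int)}"
proof (rule finite_subset)
  show "{x \<in> X \<rightarrow>\<^sub>E UNIV. (\<Sum>v\<in>X. \<bar>x v\<bar>) \<le> m} \<subseteq> X \<rightarrow>\<^sub>E {-m..m}"
  proof
    fix x assume x: "x \<in> {x \<in> X \<rightarrow>\<^sub>E UNIV. (\<Sum>v\<in>X. \<bar>x v\<bar>) \<le> m}"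
    have "x v \<in> {-m..m}" if "v \<in> X" for v
    proof -
      have "\<bar>x v\<bar> \<le> m"
        using member_le_sum[OF that, of "\<lambda>v. \<bar>x v\<bar>"] assms x by simp
      then show ?thesis unfolding atLeastAtMost_iff by linarith
    qed
    with x show "x \<in> X \<rightarrow>\<^sub>E {-m..m}" by (simp add: PiE_iff)
  qed
qed (use assms in \<open>auto intro: finite_PiE\<close>)

lemma sum_pos_neg:
  fixes x :: "'b \<Rightarrow> int"
  shows "(\<Sum>v\<in>X. \<bar>x v\<bar>) = (\<Sum>v\<in>X. max 0 (x v)) + (\<Sum>v\<in>X. max 0 (- x v))"
    and "sum x X = (\<Sum>v\<in>X. max 0 (x v)) - (\<Sum>v\<in>X. max 0 (- x v))"
  unfolding sum.distrib[symmetric] sum_subtractf[symmetric] by (intro sum.cong; simp)+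

lemma finite_int_ball: "finite X \<Longrightarrow> finite (int_ball X k m)"
  by (rule finite_subset[OF _ finite_bounded_int_functions[of X "int m"]]) (auto simp: int_ball_def)

lemma finite_int_quadrant: "finite X \<Longrightarrow> finite (int_quadrant X p q)"
  by (rule finite_subset[OF _ finite_bounded_int_functions[of X "int p + int q"]])
    (auto simp: int_quadrant_def sum_pos_neg(1))

text \<open>The hockey-stick identity; the three terms correspond to a new coordinate that is zero,
  positive or negative.\<close>

lemma quadrant_count_Suc:
  "quadrant_count (Suc a) p q =
    quadrant_count a p q + (\<Sum>k<p. quadrant_count a k q) + (\<Sum>k<q. quadrant_count a p k)"
proof -
  have hockey: "p choose Suc i = (\<Sum>k<p. k choose i)" for p i
    by (induction p) simp_all
  show ?thesis
    unfolding quadrant_count_def trinomial_sum.simps hockey sum_distrib_left sum_distrib_right trinomial_sum_sum ..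
qed

lemma quadrant_count_commute: "quadrant_count a p q = quadrant_count a q p"
  unfolding quadrant_count_def
  by (subst trinomial_sum_swap[symmetric]) (simp add: mult.commute)

lemma quadrant_count_0_0: "quadrant_count a 0 0 = 1"
  unfolding quadrant_count_def by (induction a) simp_all

text \<open>Here \<open>k\<close> is the value of one coordinate. As \<open>nat\<close> sends
  negative numbers to 0, it uses up only one of the budgets \<open>p\<close> and
  \<open>q\<close>.\<close>

lemma sum_int_interval_split:
  "(\<Sum>k\<in>{- int q..int p}. f (p - nat k) (q - nat (- k))) = f p q + (\<Sum>k<p. f k q) + (\<Sum>k<q. f p k)"
  for f :: "nat \<Rightarrow> nat \<Rightarrow> nat"
proof -
  let ?g = "\<lambda>k. f (p - nat k) (q - nat (- k))"
  have "{- int q..int p} = {0} \<union> ({1..int p} \<union> {- int q..-1})" by auto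
  then have "(\<Sum>k\<in>{- int q..int p}. ?g k) = ?g 0 + ((\<Sum>k\<in>{1..int p}. ?g k) + (\<Sum>k\<in>{- int q..-1}. ?g k))"
    by (simp add: sum.union_disjoint)
  moreover have "(\<Sum>k\<in>{1..int p}. ?g k) = (\<Sum>k<p. f k q)"
    by (rule sum.reindex_bij_witness[of _ "\<lambda>j. int (p - j)" "\<lambda>k. p - nat k"]) auto
  moreover have "(\<Sum>k\<in>{- int q..-1}. ?g k) = (\<Sum>k<q. f p k)"
    by (rule sum.reindex_bij_witness[of _ "\<lambda>j. - int (q - j)" "\<lambda>k. q - nat (- k)"]) auto
  ultimately show ?thesis by simp
qed

lemma max_add_le: "k \<le> int p \<Longrightarrow> max 0 k + s \<le> int p \<longleftrightarrow> s \<le> int (p - nat k)"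
  by (cases "0 \<le> k") auto

text \<open>Fixing the value of one coordinate leaves the same problem with smaller budgets, which
  is the recurrence \<open>quadrant_count_Suc\<close>.\<close>

lemma card_int_quadrant:
  assumes "finite X"
  shows "card (int_quadrant X p q) = quadrant_count (card X) p q"
  using assms
proof (induction X arbitrary: p q rule: finite_induct)
  case empty
  show ?case by (simp add: int_quadrant_def quadrant_count_def)
next
  case (insert v X)
  have upd: "(\<Sum>u\<in>X. h ((x(v := k)) u)) = (\<Sum>u\<in>X. h (x u))" for h :: "int \<Rightarrow> int" and x k
    using insert.hyps by (intro sum.cong) auto
  let ?S = "SIGMA k:{- int q..int p}. int_quadrant X (p - nat k) (q - nat (- k))"
  have "bij_betw (\<lambda>(k, x). x(v := k)) ?S (int_quadrant (insert v X) p q)"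
  proof (rule bij_betwI[where g = "\<lambda>x. (x v, restrict x X)"])
    show "(\<lambda>(k, x). x(v := k)) \<in> ?S \<rightarrow> int_quadrant (insert v X) p q"
    proof clarify
      fix k x assume k: "k \<in> {- int q..int p}" and x: "x \<in> int_quadrant X (p - nat k) (q - nat (- k))"
      have "(\<Sum>u\<in>X. max 0 (x u)) \<le> int (p - nat k)" "(\<Sum>u\<in>X. max 0 (- x u)) \<le> int (q - nat (- k))"
        using x by (auto simp: int_quadrant_def)
      then have "max 0 k + (\<Sum>u\<in>X. max 0 (x u)) \<le> int p" "max 0 (- k) + (\<Sum>u\<in>X. max 0 (- x u)) \<le> int q"
        using k by (simp_all add: max_add_le)
      moreover have "x(v := k) \<in> insert v X \<rightarrow>\<^sub>E UNIV"
        using x by (auto simp: int_quadrant_def PiE_iff extensional_def)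
      moreover have "(\<Sum>u\<in>insert v X. max 0 ((x(v := k)) u)) = max 0 k + (\<Sum>u\<in>X. max 0 (x u))"
        "(\<Sum>u\<in>insert v X. max 0 (- (x(v := k)) u)) = max 0 (- k) + (\<Sum>u\<in>X. max 0 (- x u))"
        using insert.hyps upd[of "max 0" x k] upd[of "\<lambda>y. max 0 (- y)" x k] by simp_all
      ultimately show "x(v := k) \<in> int_quadrant (insert v X) p q"
        unfolding int_quadrant_def by (intro CollectI conjI; simp only:)
    qed
    show "(\<lambda>x. (x v, restrict x X)) \<in> int_quadrant (insert v X) p q \<rightarrow> ?S"
    proof
      fix x assume "x \<in> int_quadrant (insert v X) p q"
      then have *: "max 0 (x v) + (\<Sum>u\<in>X. max 0 (x u)) \<le> int p" "max 0 (- x v) + (\<Sum>u\<in>X. max 0 (- x u)) \<le> int q"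
        using insert.hyps by (auto simp: int_quadrant_def)
      have pn: "0 \<le> (\<Sum>u\<in>X. max 0 (x u))" "0 \<le> (\<Sum>u\<in>X. max 0 (- x u))"
        by (simp_all add: sum_nonneg)
      then have k: "x v \<le> int p" "- x v \<le> int q" using * by linarith+
      then have "x v \<in> {- int q..int p}" by simp
      moreover have "restrict x X \<in> int_quadrant X (p - nat (x v)) (q - nat (- x v))"
        using * k by (simp add: int_quadrant_def max_add_le)
      ultimately show "(x v, restrict x X) \<in> ?S" by simp
    qed
    show "(\<lambda>x. (x v, restrict x X)) ((\<lambda>(k, x). x(v := k)) y) = y" if y: "y \<in> ?S" for y
    proof -
      obtain k c where "y = (k, c)" "c \<in> extensional X"
        using y by (auto simp: int_quadrant_def PiE_iff)
      then show ?thesis using insert.hyps by (auto simp: fun_eq_iff restrict_def extensional_def)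
    qed
    show "(\<lambda>(k, x). x(v := k)) (x v, restrict x X) = x" if "x \<in> int_quadrant (insert v X) p q" for x
      using that by (auto simp: int_quadrant_def PiE_iff fun_eq_iff restrict_def extensional_def)
  qed
  then have "card (int_quadrant (insert v X) p q) = (\<Sum>k\<in>{- int q..int p}. card (int_quadrant X (p - nat k) (q - nat (- k))))"
    using insert.hyps by (simp add: bij_betw_same_card[symmetric] card_SigmaI finite_int_quadrant)
  also have "\<dots> = quadrant_count (card (insert v X)) p q"
    unfolding insert.IH sum_int_interval_split using insert.hyps by (simp add: quadrant_count_Suc)
  finally show ?case .
qed

text \<open>One coordinate of a point with prescribed coordinate sum is redundant, and for the sum \<open>p - q\<close>
  the bound \<open>p + q\<close> on the norm says that the positive part is at most \<open>p\<close> and the negative part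
  at most \<open>q\<close>.\<close>

lemma card_int_ball:
  assumes "finite X" "card X = Suc n"
  shows "card (int_ball X (int p - int q) (p + q)) = quadrant_count n p q"
proof -
  obtain v Y where X: "X = insert v Y" "v \<notin> Y" "finite Y" "card Y = n"
    using assms by (metis card_Suc_eq finite_insert)
  let ?B = "int_ball X (int p - int q) (p + q)"
  have ball: "x \<in> ?B \<longleftrightarrow> x \<in> X \<rightarrow>\<^sub>E UNIV \<and> sum x X = int p - int q \<and>
      (\<Sum>u\<in>X. max 0 (x u)) \<le> int p \<and> (\<Sum>u\<in>X. max 0 (- x u)) \<le> int q" for x
    unfolding int_ball_def using sum_pos_neg[of x X] by auto
  have "bij_betw (\<lambda>x. restrict x Y) ?B (int_quadrant Y p q)"
  proof (rule bij_betwI[where g = "\<lambda>x. x(v := int p - int q - sum x Y)"])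
    show "(\<lambda>x. restrict x Y) \<in> ?B \<rightarrow> int_quadrant Y p q"
    proof
      fix x assume "x \<in> ?B"
      then have "max 0 (x v) + (\<Sum>u\<in>Y. max 0 (x u)) \<le> int p" "max 0 (- x v) + (\<Sum>u\<in>Y. max 0 (- x u)) \<le> int q"
        unfolding ball using X by simp_all
      moreover have "0 \<le> max 0 (x v)" "0 \<le> max 0 (- x v)" by simp_all
      ultimately have "(\<Sum>u\<in>Y. max 0 (x u)) \<le> int p" "(\<Sum>u\<in>Y. max 0 (- x u)) \<le> int q"
        by linarith+
      then show "restrict x Y \<in> int_quadrant Y p q" by (simp add: int_quadrant_def)
    qed
    show "(\<lambda>x. x(v := int p - int q - sum x Y)) \<in> int_quadrant Y p q \<rightarrow> ?B"
    proof
      fix x assume x: "x \<in> int_quadrant Y p q"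
      let ?k = "int p - int q - sum x Y"
      have upd: "(\<Sum>u\<in>Y. h ((x(v := ?k)) u)) = (\<Sum>u\<in>Y. h (x u))" for h :: "int \<Rightarrow> int"
        using X by (intro sum.cong) auto
      \<comment> \<open>Let P and N be the sums of the positive and negative parts over
        \<open>Y\<close>. If \<open>?k\<close> is nonnegative, then ?k + P = p - q + N, at most p
        because N <= q; the other sign is symmetric.\<close>
      have "max 0 ?k + (\<Sum>u\<in>Y. max 0 (x u)) \<le> int p" "max 0 (- ?k) + (\<Sum>u\<in>Y. max 0 (- x u)) \<le> int q"
        using x sum_pos_neg(2)[of x Y] by (auto simp: int_quadrant_def)
      moreover have "x(v := ?k) \<in> insert v Y \<rightarrow>\<^sub>E UNIV"
        using x by (auto simp: int_quadrant_def PiE_iff extensional_def)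
      moreover have "sum (x(v := ?k)) (insert v Y) = int p - int q"
        "(\<Sum>u\<in>insert v Y. max 0 ((x(v := ?k)) u)) = max 0 ?k + (\<Sum>u\<in>Y. max 0 (x u))"
        "(\<Sum>u\<in>insert v Y. max 0 (- (x(v := ?k)) u)) = max 0 (- ?k) + (\<Sum>u\<in>Y. max 0 (- x u))"
        using X(2,3) upd[of "\<lambda>y. y"] upd[of "max 0"] upd[of "\<lambda>y. max 0 (- y)"] by simp_all
      ultimately show "x(v := ?k) \<in> ?B" unfolding ball unfolding X(1) by (intro conjI; simp only:)
    qed
    show "(restrict x Y)(v := int p - int q - sum (restrict x Y) Y) = x" if x: "x \<in> ?B" for x
    proof -
      have "x v = int p - int q - sum x Y" "x \<in> extensional (insert v Y)"
        using x X by (auto simp: int_ball_def PiE_iff)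
      then show ?thesis by (auto simp: fun_eq_iff restrict_def extensional_def)
    qed
    show "restrict (x(v := int p - int q - sum x Y)) Y = x" if "x \<in> int_quadrant Y p q" for x
      using that X by (auto simp: int_quadrant_def PiE_iff fun_eq_iff restrict_def extensional_def)
  qed
  then show ?thesis using X by (simp add: bij_betw_same_card card_int_quadrant)
qed

text \<open>The norm has the parity of the coordinate sum, so the value \<open>Suc m\<close> is not
  attained.\<close>

lemma int_ball_parity:
  assumes "odd (k + int (Suc m))"
  shows "int_ball X k (Suc m) = int_ball X k m"
proof -
  have "(\<Sum>v\<in>X. \<bar>x v\<bar>) \<le> int m" if "sum x X = k" "(\<Sum>v\<in>X. \<bar>x v\<bar>) \<le> int (Suc m)" for x
  proof -
    have "(\<Sum>v\<in>X. \<bar>x v\<bar>) = k + 2 * (\<Sum>v\<in>X. max 0 (- x v))"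
      using sum_pos_neg[of x X] that(1) by simp
    then have "(\<Sum>v\<in>X. \<bar>x v\<bar>) \<noteq> int (Suc m)" using assms by presburger
    then show ?thesis using that(2) by simp
  qed
  then show ?thesis by (auto simp: int_ball_def)
qed

text \<open>The first sum runs over k = p - q with p + q = m, the second over k = p - q with p + q =
  m - 1.\<close>

lemma sum_parity_split:
  "(\<Sum>k\<in>{- int m..int m}. g k) = (\<Sum>p\<le>m. g (2 * int p - int m)) + (\<Sum>p<m. g (2 * int p - int m + 1))"
  for g :: "int \<Rightarrow> nat"
proof -
  let ?f = "\<lambda>p. 2 * int p - int m" and ?h = "\<lambda>p. 2 * int p - int m + 1"
  have "{- int m..int m} = ?f ` {..m} \<union> ?h ` {..<m}"
  proof (intro equalityI subsetI)
    fix k assume k: "k \<in> {- int m..int m}"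
    show "k \<in> ?f ` {..m} \<union> ?h ` {..<m}"
    proof (cases "even (k + int m)")
      case True
      then obtain j where "k + int m = 2 * j" by (elim evenE)
      then have "k = ?f (nat j)" "nat j \<le> m" using k by auto
      then show ?thesis by blast
    next
      case False
      then obtain j where "k + int m = 2 * j + 1" by (elim oddE)
      then have "k = ?h (nat j)" "nat j < m" using k by auto
      then show ?thesis by blast
    qed
  qed auto
  moreover have "?f ` {..m} \<inter> ?h ` {..<m} = {}" by (auto, presburger)
  ultimately have "(\<Sum>k\<in>{- int m..int m}. g k) = sum g (?f ` {..m}) + sum g (?h ` {..<m})"
    by (simp add: sum.union_disjoint)
  then show ?thesis by (simp add: sum.reindex inj_on_def)
qed

section \<open>Lattice points of the dilated polytope and of its boundary\<close>

definition lattice_ball :: "'v set \<Rightarrow> 'v set \<Rightarrow> nat \<Rightarrow> (real ^ 'v::finite) set" where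
  "lattice_ball A B m = {z \<in> integer_lattice. (\<Sum>i\<in>UNIV. z $ i) = 0 \<and> max (abs_sum A z) (abs_sum B z) \<le> real m}"

text \<open>Once the sum \<open>k\<close> over \<open>A\<close> is fixed, the two parts are
  independent, with sum \<open>- k\<close> over \<open>B\<close>. The norm bounds the sum, so k lies
  between -m and m.\<close>

lemma lattice_ball_bij:
  fixes A B :: "'v::finite set"
  assumes AB: "A \<inter> B = {}" "A \<union> B = UNIV"
  shows "bij_betw (\<lambda>(k, x, y). \<chi> i. real_of_int (if i \<in> A then x i else y i))
    (SIGMA k:{- int m..int m}. int_ball A k m \<times> int_ball B (- k) m) (lattice_ball A B m)"
    (is "bij_betw ?f ?S _")
proof (rule bij_betwI[where g = "\<lambda>z. (\<Sum>i\<in>A. \<lfloor>z $ i\<rfloor>, \<lambda>i\<in>A. \<lfloor>z $ i\<rfloor>, \<lambda>i\<in>B. \<lfloor>z $ i\<rfloor>)"])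
  have UN: "sum h UNIV = sum h A + sum h B" for h :: "'v \<Rightarrow> 'c::comm_monoid_add"
    using AB by (simp add: sum.union_disjoint flip: AB(2))
  have notA: "i \<notin> A" if "i \<in> B" for i using AB that by blast
  show "?f \<in> ?S \<rightarrow> lattice_ball A B m"
  proof clarify
    fix k x y assume x: "x \<in> int_ball A k m" and y: "y \<in> int_ball B (- k) m"
    let ?z = "\<chi> i. real_of_int (if i \<in> A then x i else y i) :: real ^ 'v"
    have "(\<Sum>i\<in>A. ?z $ i) = of_int (sum x A)" "(\<Sum>i\<in>B. ?z $ i) = of_int (sum y B)"
      "abs_sum A ?z = of_int (\<Sum>i\<in>A. \<bar>x i\<bar>)" "abs_sum B ?z = of_int (\<Sum>i\<in>B. \<bar>y i\<bar>)"
      unfolding abs_sum_def of_int_sum using notA by (auto intro!: sum.cong)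
    moreover have "sum x A + sum y B = 0" "(\<Sum>i\<in>A. \<bar>x i\<bar>) \<le> int m" "(\<Sum>i\<in>B. \<bar>y i\<bar>) \<le> int m"
      using x y by (auto simp: int_ball_def)
    ultimately show "?z \<in> lattice_ball A B m"
      unfolding lattice_ball_def UN
      by (simp add: integer_lattice_def del: of_int_sum flip: of_int_add)
  qed
  have fl: "real_of_int \<lfloor>z $ i\<rfloor> = z $ i" if "z \<in> lattice_ball A B m" for z i
    using that by (auto simp: lattice_ball_def integer_lattice_def)
  show "(\<lambda>z. (\<Sum>i\<in>A. \<lfloor>z $ i\<rfloor>, \<lambda>i\<in>A. \<lfloor>z $ i\<rfloor>, \<lambda>i\<in>B. \<lfloor>z $ i\<rfloor>)) \<in> lattice_ball A B m \<rightarrow> ?S"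
  proof
    fix z assume z: "z \<in> lattice_ball A B m"
    have sum0: "(\<Sum>i\<in>A. \<lfloor>z $ i\<rfloor>) + (\<Sum>i\<in>B. \<lfloor>z $ i\<rfloor>) = 0"
    proof -
      have "real_of_int ((\<Sum>i\<in>A. \<lfloor>z $ i\<rfloor>) + (\<Sum>i\<in>B. \<lfloor>z $ i\<rfloor>)) = 0"
        using z by (simp add: fl[OF z] UN[symmetric] lattice_ball_def)
      then show ?thesis by linarith
    qed
    have le: "(\<Sum>i\<in>X. \<bar>\<lfloor>z $ i\<rfloor>\<bar>) \<le> int m" if "abs_sum X z \<le> real m" for X
    proof -
      have "real_of_int (\<Sum>i\<in>X. \<bar>\<lfloor>z $ i\<rfloor>\<bar>) \<le> real m"
        using that by (simp add: abs_sum_def fl[OF z])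
      then show ?thesis by linarith
    qed
    have leA: "(\<Sum>i\<in>A. \<bar>\<lfloor>z $ i\<rfloor>\<bar>) \<le> int m" and leB: "(\<Sum>i\<in>B. \<bar>\<lfloor>z $ i\<rfloor>\<bar>) \<le> int m"
      using z by (auto simp: lattice_ball_def intro!: le)
    have "\<bar>\<Sum>i\<in>A. \<lfloor>z $ i\<rfloor>\<bar> \<le> (\<Sum>i\<in>A. \<bar>\<lfloor>z $ i\<rfloor>\<bar>)" by (rule sum_abs)
    then have "(\<Sum>i\<in>A. \<lfloor>z $ i\<rfloor>) \<in> {- int m..int m}"
      using leA unfolding atLeastAtMost_iff by linarith
    then show "(\<Sum>i\<in>A. \<lfloor>z $ i\<rfloor>, \<lambda>i\<in>A. \<lfloor>z $ i\<rfloor>, \<lambda>i\<in>B. \<lfloor>z $ i\<rfloor>) \<in> ?S"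
      using leA leB sum0 by (auto simp: int_ball_def)
  qed
  show "(\<Sum>i\<in>A. \<lfloor>?f u $ i\<rfloor>, \<lambda>i\<in>A. \<lfloor>?f u $ i\<rfloor>, \<lambda>i\<in>B. \<lfloor>?f u $ i\<rfloor>) = u" if u: "u \<in> ?S" for u
  proof -
    obtain k x y where u': "u = (k, x, y)" "x \<in> int_ball A k m" "y \<in> int_ball B (- k) m" using u by auto
    then have "x \<in> extensional A" "y \<in> extensional B" "sum x A = k" by (auto simp: int_ball_def PiE_iff)
    then show ?thesis using notA by (auto simp: u'(1) fun_eq_iff restrict_def extensional_def)
  qed
  show "?f (\<Sum>i\<in>A. \<lfloor>z $ i\<rfloor>, \<lambda>i\<in>A. \<lfloor>z $ i\<rfloor>, \<lambda>i\<in>B. \<lfloor>z $ i\<rfloor>) = z" if "z \<in> lattice_ball A B m" for z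
  proof -
    have "i \<in> B" if "i \<notin> A" for i using AB that by blast
    then show ?thesis using fl[OF that] by (auto simp: vec_eq_iff)
  qed
qed

text \<open>Sums \<open>k\<close> of the parity of \<open>m\<close> contribute coefficient
  \<open>m\<close> of the quadrant series. For the other parity the radius may be lowered by 1,
  which contributes coefficient \<open>m - 1\<close>.\<close>

lemma lattice_ball_series:
  fixes A B :: "'v::finite set"
  assumes AB: "A \<inter> B = {}" "A \<union> B = UNIV" and card: "card A = a + 1" "card B = b + 1"
  shows "finite (lattice_ball A B m)"
    and "Abs_fps (\<lambda>m. int (card (lattice_ball A B m))) = (1 + fps_X) * quadrant_series a b"
proof -
  have fin: "finite (int_ball A k m \<times> int_ball B l m)" for k l m
    by (simp add: finite_int_ball)
  show "finite (lattice_ball A B m)"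
    using bij_betw_finite[OF lattice_ball_bij[OF AB]] fin by (simp add: finite_SigmaI)
  define g where "g m k = card (int_ball A k m) * card (int_ball B (- k) m)" for m k
  define M where "M m = (\<Sum>p\<le>m. quadrant_count a p (m - p) * quadrant_count b p (m - p))" for m
  have N: "card (lattice_ball A B m) = (\<Sum>k\<in>{- int m..int m}. g m k)" for m
    using bij_betw_same_card[OF lattice_ball_bij[OF AB]] fin
    by (simp add: card_SigmaI card_cartesian_product g_def)
  \<comment> \<open>On \<open>B\<close> the sum has the opposite sign, so the budgets appear
    exchanged; \<open>quadrant_count_commute\<close> restores their order.\<close>
  have ev: "g m (2 * int p - int m) = quadrant_count a p (m - p) * quadrant_count b p (m - p)" if "p \<le> m" for m p
  proof -
    have "int_ball A (2 * int p - int m) m = int_ball A (int p - int (m - p)) (p + (m - p))"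
      "int_ball B (- (2 * int p - int m)) m = int_ball B (int (m - p) - int p) ((m - p) + p)"
      using that by simp_all
    then have "card (int_ball A (2 * int p - int m) m) = quadrant_count a p (m - p)"
      "card (int_ball B (- (2 * int p - int m)) m) = quadrant_count b (m - p) p"
      using card card_int_ball[of A a p "m - p"] card_int_ball[of B b "m - p" p] by simp_all
    then show ?thesis by (simp only: g_def quadrant_count_commute[of b "m - p" p])
  qed
  have od: "g (Suc m) (2 * int p - int m) = g m (2 * int p - int m)" for m p
  proof -
    have "odd (2 * int p - int m + int (Suc m))" "odd (- (2 * int p - int m) + int (Suc m))" by simp_all
    note parity = this[THEN int_ball_parity]
    show ?thesis unfolding g_def parity ..
  qed
  show "Abs_fps (\<lambda>m. int (card (lattice_ball A B m))) = (1 + fps_X) * quadrant_series a b"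
  proof (rule fps_ext)
    fix m
    show "fps_nth (Abs_fps (\<lambda>m. int (card (lattice_ball A B m)))) m = fps_nth ((1 + fps_X) * quadrant_series a b) m"
    proof (cases m)
      case 0
      then show ?thesis using ev[of 0 0] by (simp add: N quadrant_series_def distrib_right)
    next
      case (Suc n)
      have "card (lattice_ball A B m) = (\<Sum>p\<le>m. g m (2 * int p - int m)) + (\<Sum>p<m. g m (2 * int p - int m + 1))"
        unfolding N by (rule sum_parity_split)
      also have "(\<Sum>p\<le>m. g m (2 * int p - int m)) = M m"
        unfolding M_def by (intro sum.cong) (auto simp: ev)
      also have "(\<Sum>p<m. g m (2 * int p - int m + 1)) = (\<Sum>p\<le>n. g n (2 * int p - int n))"
      proof (rule sum.cong)
        show "g m (2 * int p - int m + 1) = g n (2 * int p - int n)" for p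
          using od[of n p] by (simp add: Suc)
      qed (auto simp: Suc)
      also have "\<dots> = M n"
        unfolding M_def by (intro sum.cong) (auto simp: ev)
      finally have "card (lattice_ball A B m) = M m + M n" .
      moreover have "fps_nth (quadrant_series a b) m = int (M m)" "fps_nth (quadrant_series a b) n = int (M n)"
        by (simp_all add: quadrant_series_def M_def)
      ultimately show ?thesis by (simp add: Suc distrib_right)
    qed
  qed
qed

text \<open>Provides a boundary point, so that a triangulation of the boundary is nonempty.\<close>

lemma axis_diff_in_frontier:
  fixes A B :: "'v::finite set"
  assumes "A \<inter> B = {}" "v \<in> A" "w \<in> B"
  shows "axis v 1 - axis w 1 \<in> rel_frontier (bipartite_ball A B)"
proof -
  have "v \<notin> B" "w \<notin> A" using assms by auto
  have "abs_sum A (axis v 1 - axis w 1) = (\<Sum>i\<in>A. if i = v then 1 else 0)"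
    unfolding abs_sum_def using \<open>w \<notin> A\<close> by (intro sum.cong) (auto simp: axis_def)
  moreover have "abs_sum B (axis v 1 - axis w 1) = (\<Sum>i\<in>B. if i = w then 1 else 0)"
    unfolding abs_sum_def using \<open>v \<notin> B\<close> by (intro sum.cong) (auto simp: axis_def)
  moreover have "(\<Sum>i\<in>UNIV. (axis v 1 - axis w (1::real)) $ i) = 0"
    by (simp add: sum_subtractf axis_def)
  ultimately show ?thesis using assms by (simp add: rel_frontier_bipartite_ball)
qed

text \<open>Both norms are integers at lattice points, so their maximum is n + 1 exactly if it is at
  most n + 1 but not at most n.\<close>

lemma lattice_points_frontier:
  fixes A B :: "'v::finite set"
  shows "{z \<in> integer_lattice. (1 / real (Suc n)) *\<^sub>R z \<in> rel_frontier (bipartite_ball A B)} =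
    lattice_ball A B (Suc n) - lattice_ball A B n"
proof -
  let ?N = "\<lambda>z :: real ^ 'v. max (abs_sum A z) (abs_sum B z)"
  have "(1 / real (Suc n)) *\<^sub>R z \<in> rel_frontier (bipartite_ball A B) \<longleftrightarrow>
      (\<Sum>i\<in>UNIV. z $ i) = 0 \<and> ?N z \<le> real (Suc n) \<and> \<not> ?N z \<le> real n"
    if z: "z \<in> integer_lattice" for z
  proof -
    have sum: "(\<Sum>i\<in>UNIV. ((1 / real (Suc n)) *\<^sub>R z) $ i) = (1 / real (Suc n)) * (\<Sum>i\<in>UNIV. z $ i)"
      by (simp add: sum_distrib_left)
    have norm: "?N ((1 / real (Suc n)) *\<^sub>R z) = (1 / real (Suc n)) * ?N z"
      by (simp add: abs_sum_scaleR max_divide_distrib_right)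
    have one: "(1 / real (Suc n)) * r = 1 \<longleftrightarrow> r = real (Suc n)" for r
      by (auto simp: field_simps)
    have int: "?N z = real (Suc n) \<longleftrightarrow> ?N z \<le> real (Suc n) \<and> \<not> ?N z \<le> real n"
    proof -
      have "abs_sum A z \<in> \<int>" "abs_sum B z \<in> \<int>"
        using z unfolding abs_sum_def integer_lattice_def by (auto intro!: Ints_sum Ints_abs)
      then have "?N z \<in> \<int>" by (simp add: max_def)
      then obtain k where k: "?N z = of_int k" by (elim Ints_cases)
      show ?thesis
        unfolding k of_int_of_nat_eq[symmetric, where 'a = real] of_int_le_iff of_int_eq_iff by arith
    qed
    show ?thesis
      unfolding rel_frontier_bipartite_ball mem_Collect_eq sum norm one int by simp
  qed
  then show ?thesis unfolding lattice_ball_def by blast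
qed

lemma gamma_coeff_commute: "gamma_coeff a b n = gamma_coeff b a n"
  by (simp add: gamma_coeff_def mult.commute)

text \<open>Boundary counts are differences of consecutive ball counts, which gives the factor 1 -
  z; together with the factor 1 + z of the ball series it becomes 1 - z^2.\<close>

lemma vertex_scheme_series:
  fixes A B :: "'v::finite set" and T :: "(real ^ 'v) set set"
  assumes AB: "A \<inter> B = {}" "A \<union> B = UNIV" "card A = a + 1" "card B = b + 1"
    and T: "simplicial_complex T" "\<Union>T = rel_frontier (bipartite_ball A B)" "T \<noteq> {}"
    and uni: "\<forall>S\<in>T. unimodular_lattice_simplex S"
  shows "(\<Sum>F\<in>vertex_scheme T. geo_tail ^ card F) = (1 - fps_X\<^sup>2) * quadrant_series a b"
proof -
  let ?N = "\<lambda>m. card (lattice_ball A B m)" and ?f = "\<Sum>F\<in>vertex_scheme T. geo_tail ^ card F"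
  note series = lattice_ball_series[OF AB]
  have "?f = (1 - fps_X) * Abs_fps (\<lambda>m. int (?N m))"
  proof (rule fps_ext)
    fix m
    show "fps_nth ?f m = fps_nth ((1 - fps_X) * Abs_fps (\<lambda>m. int (?N m))) m"
    proof (cases m)
      case 0
      have "int (?N 0) = fps_nth ((1 + fps_X) * quadrant_series a b) 0"
        using series(2) by (metis fps_nth_Abs_fps)
      also have "\<dots> = 1" by (simp add: quadrant_series_def quadrant_count_0_0)
      finally show ?thesis using 0 vertex_scheme_series_0(3)[OF T(1,3)] by simp
    next
      case (Suc n)
      have "lattice_ball A B n \<subseteq> lattice_ball A B (Suc n)" by (auto simp: lattice_ball_def)
      then have "int (card (lattice_ball A B (Suc n) - lattice_ball A B n)) = int (?N (Suc n)) - int (?N n)"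
        using series(1) by (simp add: card_Diff_subset card_mono of_nat_diff)
      then have "fps_nth ?f (Suc n) = int (?N (Suc n)) - int (?N n)"
        using card_lattice_points_unimodular_complex[OF T(1) uni, of "Suc n"]
        unfolding T(2) lattice_points_frontier by simp
      then show ?thesis by (simp add: Suc left_diff_distrib)
    qed
  qed
  also have "\<dots> = (1 - fps_X\<^sup>2) * quadrant_series a b"
    unfolding series(2) by (simp add: algebra_simps power2_eq_square)
  finally show ?thesis .
qed

theorem theorem4p12:
  fixes a b :: nat and A B :: "'v::finite set" and T :: "(real ^ 'v) set set"
  assumes "A \<inter> B = {}" and "A \<union> B = UNIV" and "card A = a + 1" and "card B = b + 1"
    and "boundary_triangulation T (symmetric_edge_polytope (complete_bipartite_edges A B))"
    and "\<forall>S\<in>T. unimodular_lattice_simplex S"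
    and "flag_complex (vertex_scheme T)"
  shows "\<exists>\<gamma>. gamma_expansion (a + b + 1) (h_polynomial (vertex_scheme T)) \<gamma> \<and>
           (\<exists>K :: nat set set. abstract_complex K \<and> flag_complex K \<and> balanced_complex K \<and>
              f_polynomial K = \<gamma>)"
proof -
  \<comment> \<open>The smaller number comes first, as the coloring of
    \<open>signed_matching_complex\<close> requires; \<open>gamma_coeff\<close> is symmetric in
    \<open>a\<close> and \<open>b\<close>.\<close>
  let ?K = "signed_matching_complex (min a b) (max a b)"
  have ne: "A \<noteq> {}" "B \<noteq> {}" using assms(3,4) by auto
  have T: "simplicial_complex T" "\<Union>T = rel_frontier (bipartite_ball A B)"
    using assms(5) symmetric_edge_polytope_complete_bipartite[OF assms(1,2) ne]
    by (simp_all add: boundary_triangulation_def)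
  obtain v w where "v \<in> A" "w \<in> B" using ne by blast
  \<comment> \<open>Rules out \<open>T = {}\<close>, whose vertex scheme would not even contain the
    empty face.\<close>
  then have "\<Union>T \<noteq> {}" using axis_diff_in_frontier[OF assms(1)] T(2) by blast
  then have "T \<noteq> {}" by auto
  have "min a b \<le> max a b" by simp
  note K = signed_matching_complex[OF this]
  have "gamma_expansion (a + b + 1) (h_polynomial (vertex_scheme T)) (f_polynomial ?K)"
  proof (rule gamma_expansion_h_polynomial)
    show "finite (vertex_scheme T)" "vertex_scheme T \<noteq> {}"
      using vertex_scheme_series_0(1,2)[OF T(1) \<open>T \<noteq> {}\<close>] by auto
    show "(\<Sum>F\<in>vertex_scheme T. geo_tail ^ card F) = (1 - fps_X\<^sup>2) * quadrant_series a b"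
      using assms(1-4,6) T \<open>T \<noteq> {}\<close> by (intro vertex_scheme_series)
    show "2 * degree (f_polynomial ?K) \<le> a + b + 1" using K(5) by linarith
    show "coeff (f_polynomial ?K) n = int (gamma_coeff a b n)" for n
      using K(4)[of n] gamma_coeff_commute[of a b] by (simp add: min_def max_def)
  qed
  moreover have "\<exists>K' :: nat set set. abstract_complex K' \<and> flag_complex K' \<and> balanced_complex K' \<and>
      f_polynomial K' = f_polynomial ?K"
    by (rule flag_balanced_complex_nat_copy[OF K(1-3)])
  ultimately show ?thesis by blast
qed

end
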